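(* Let $n,m$ be integers with $0<m\le n$. Then the family of isotropic orthogonal projections $\{P_V:\mathbb{R}^{2n}\to V\}_{V\in G_h(n,m)}$ is transversal, in the following local sense: every $V_0\in G_h(n,m)$ has a coordinate neighbourhood $U\subset G_h(n,m)$, identified via a chart with an open set $\Lambda\subset\mathbb{R}^{l}$, $l=2nm-\frac{m(3m-1)}{2}$ (and with each $P_V$, $V\in U$, regarded as a map $\mathbb{R}^{2n}\to\mathbb{R}^m$ by means of an orthonormal basis of $V$ depending smoothly on $V\in U$), such that the family $\{P_V\}_{V\in U}$ is transversal in the sense defined below.
   Context: Let $\omega$ be the standard symplectic form on $\mathbb{R}^{2n}$, $\omega(x,y)=\sum_{i=1}^n (x_{i+n}y_i-x_iy_{i+n})$. A linear subspace $V\subset\mathbb{R}^{2n}$ is isotropic if $\omega(v,w)=0$ for all $v,w\in V$. $G_h(n,m)$ denotes the isotropic Grassmannian: the set of all $m$-dimensional isotropic linear subspaces of $\mathbb{R}^{2n}$; it is a smooth compact submanifold of the Grassmannian $G(2n,m)$ of dimension $2nm-\frac{m(3m-1)}{2}$. $P_V$ denotes the orthogonal projection of $\mathbb{R}^{2n}$ onto $V$. Transversality: Let $\Lambda\subset\mathbb{R}^l$ be open. A family of maps $\{\pi_\lambda:\mathbb{R}^N\to\mathbb{R}^m\}_{\lambda\in\Lambda}$ is transversal if for each compact $K\subset\mathbb{R}^N$: (1) the map $\Lambda\times K\to\mathbb{R}^m$, $(\lambda,x)\mapsto\pi_\lambda(x)$, is continuously differentiable and twice differentiable in $\lambda$;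 (2) for $j=1,2$ there are constants $C_j$ with $\|D^j_\lambda\pi_\lambda(x)\|\le C_j$ for all $(\lambda,x)\in\Lambda\times K$; (3) setting $\Phi_{x,y}(\lambda)=\frac{\pi_\lambda(x)-\pi_\lambda(y)}{\|x-y\|}$ for $x\ne y$ in $K$, there is a constant $C_T>0$ such that $\|\Phi_{x,y}(\lambda)\|\le C_T$ implies $\det\big(D_\lambda\Phi_{x,y}(\lambda)(D_\lambda\Phi_{x,y}(\lambda))^T\big)\ge C_T^2$; (4) there is a constant $C_L$ with $\|D^2_\lambda\Phi_{x,y}(\lambda)\|\le C_L$ for all $\lambda\in\Lambda$ and $x\ne y$ in $K$. *)

theory Defs
  imports "HOL-Analysis.Analysis"
begin

text \<open>Vectors of R^(2n) are indexed by the type 'n + 'n (CARD('n) = n):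
  coordinate i (1 \<le> i \<le> n) is Inl i, coordinate i+n is Inr i.\<close>

definition symp :: "real^('n::finite + 'n) \<Rightarrow> real^('n + 'n) \<Rightarrow> real" where
  "symp x y = (\<Sum>i\<in>UNIV. x $ Inr i * y $ Inl i - x $ Inl i * y $ Inr i)"

definition isotropic :: "(real^('n::finite + 'n)) set \<Rightarrow> bool" where
  "isotropic V \<longleftrightarrow> (\<forall>v\<in>V. \<forall>w\<in>V. symp v w = 0)"

definition iso_grass :: "nat \<Rightarrow> (real^('n::finite + 'n)) set set" where
  "iso_grass m = {V. subspace V \<and> dim V = m \<and> isotropic V}"

definition proj :: "('a::euclidean_space) set \<Rightarrow> 'a \<Rightarrow> 'a" where
  "proj V x = (THE y. y \<in> V \<and> (\<forall>v\<in>V. inner (x - y) v = 0))"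

text \<open>Standard embedding of the Grassmannian: V \<mapsto> matrix of P_V
  (this induces the manifold topology/smooth structure).\<close>
definition projmat :: "(real^'k::finite) set \<Rightarrow> real^'k^'k" where
  "projmat V = matrix (proj V)"

fun Ck :: "nat \<Rightarrow> ('a::euclidean_space) set \<Rightarrow> ('a \<Rightarrow> 'b::euclidean_space) \<Rightarrow> bool" where
  "Ck 0 S f = continuous_on S f"
| "Ck (Suc k) S f = (\<exists>f'. (\<forall>x\<in>S. (f has_derivative f' x) (at x)) \<and> (\<forall>v. Ck k S (\<lambda>x. f' x v)))"

definition Phi :: "('p \<Rightarrow> 'a::real_normed_vector \<Rightarrow> 'b::real_normed_vector) \<Rightarrow> 'a \<Rightarrow> 'a \<Rightarrow> 'p \<Rightarrow> 'b" where
  "Phi \<pi> x y l = (\<pi> l x - \<pi> l y) /\<^sub>R norm (x - y)"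

definition transversal :: "(real^'p::finite) set \<Rightarrow> (real^'p \<Rightarrow> real^'N::finite \<Rightarrow> real^'m::finite) \<Rightarrow> bool" where
  "transversal \<Lambda> \<pi> \<longleftrightarrow> open \<Lambda> \<and>
    (\<forall>K. compact K \<longrightarrow>
      \<comment> \<open>(1) and (2)\<close>
      Ck 1 (\<Lambda> \<times> K) (\<lambda>z. \<pi> (fst z) (snd z)) \<and>
      (\<exists>D1 D2 C1 C2. \<forall>l\<in>\<Lambda>. \<forall>x\<in>K.
          ((\<lambda>l'. \<pi> l' x) has_derivative blinfun_apply (D1 l x)) (at l) \<and>
          ((\<lambda>l'. D1 l' x) has_derivative blinfun_apply (D2 l x)) (at l) \<and>
          norm (D1 l x) \<le> C1 \<and> norm (D2 l x) \<le> C2) \<and>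
      \<comment> \<open>(3)\<close>
      (\<exists>CT>0. \<forall>x\<in>K. \<forall>y\<in>K. x \<noteq> y \<longrightarrow> (\<forall>l\<in>\<Lambda>. \<forall>D.
          (Phi \<pi> x y has_derivative blinfun_apply D) (at l) \<longrightarrow>
          norm (Phi \<pi> x y l) \<le> CT \<longrightarrow>
          det (matrix (blinfun_apply D) ** transpose (matrix (blinfun_apply D))) \<ge> CT\<^sup>2)) \<and>
      \<comment> \<open>(4)\<close>
      (\<exists>CL. \<forall>x\<in>K. \<forall>y\<in>K. x \<noteq> y \<longrightarrow> (\<forall>DP D2P.
          (\<forall>l\<in>\<Lambda>. (Phi \<pi> x y has_derivative blinfun_apply (DP l)) (at l) \<and>
                  (DP has_derivative blinfun_apply (D2P l)) (at l)) \<longrightarrow>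
          (\<forall>l\<in>\<Lambda>. norm (D2P l) \<le> CL))))"

end

theory Submission
  imports Defs
begin

text \<open>
  Let \<open>J\<close> be the complex structure with \<open>\<omega>(x,y) = \<langle>x, J y\<rangle>\<close>, and let \<open>e0\<close> be an orthonormal basis
  of \<open>V0\<close>. A subspace near \<open>V0\<close> is the span of vectors \<open>e0\<^sub>i + g\<^sub>i\<close> with \<open>g\<^sub>i \<bottom> V0\<close>, and it is
  isotropic iff the antisymmetric part of \<open>\<langle>g\<^sub>i, J e0\<^sub>j\<rangle>\<close> equals \<open>- \<omega>(g\<^sub>i, g\<^sub>j) / 2\<close>. That part
  has no influence on \<open>\<omega>(g\<^sub>i, g\<^sub>j)\<close>, so the remaining component \<open>A\<close> of \<open>g\<close>, which ranges over a
  linear space of dimension \<open>2nm - m(3m-1)/2\<close>, is a free parameter: \<open>g\<close> is a quadratic polynomial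
  in \<open>A\<close>, and \<open>A\<close> is a linear function of \<open>g\<close>. This is the chart; Gram-Schmidt turns the vectors
  \<open>e0\<^sub>i + g\<^sub>i\<close> into a smooth orthonormal frame.

  For transversality it suffices, by compactness of the sphere, to show at the base point that for
  every unit vector \<open>u \<bottom> V0\<close> the map \<open>A \<mapsto> (\<langle>A\<^sub>i, u\<rangle>)\<^sub>i\<close> is onto. If \<open>t\<close> is orthogonal to its
  range, test with \<open>A\<^sub>i = t\<^sub>i u + \<langle>u, J e0\<^sub>i\<rangle> \<Sum>\<^sub>j t\<^sub>j J e0\<^sub>j\<close>: this gives
  \<open>0 = |t|\<^sup>2 + (\<Sum>\<^sub>i t\<^sub>i \<langle>u, J e0\<^sub>i\<rangle>)\<^sup>2\<close>.
\<close>

section \<open>Iterated differentiability\<close>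

lemma Ck_imp_continuous_on: "Ck k S f \<Longrightarrow> continuous_on S f"
  by (cases k) (auto, meson continuous_at_imp_continuous_on has_derivative_continuous)

lemma Ck_Suc_D: "Ck (Suc k) S f \<Longrightarrow> Ck k S f"
proof (induction k arbitrary: f)
  case 0
  then show ?case using Ck_imp_continuous_on[OF 0] by simp
next
  case (Suc k)
  from Suc.prems obtain f' where
    "\<forall>x\<in>S. (f has_derivative f' x) (at x)" "\<And>v. Ck (Suc k) S (\<lambda>x. f' x v)"
    by (subst (asm) Ck.simps(2)) blast
  with Suc.IH show ?case by (subst Ck.simps(2)) blast
qed

lemma Ck_const: "Ck k S (\<lambda>_. c)"
proof (induction k arbitrary: c)
  case (Suc k)
  show ?case by (subst Ck.simps(2)) (intro exI[of _ "\<lambda>_ _. 0"] conjI ballI allI Suc.IH has_derivative_const)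
qed simp

lemma Ck_bounded_linear_compose:
  assumes "bounded_linear L"
  shows "Ck k S f \<Longrightarrow> Ck k S (\<lambda>x. L (f x))"
proof (induction k arbitrary: f)
  case 0
  then show ?case using bounded_linear.continuous_on[OF assms] by simp
next
  case (Suc k)
  then obtain f' where f': "\<And>x. x \<in> S \<Longrightarrow> (f has_derivative f' x) (at x)" "\<And>v. Ck k S (\<lambda>x. f' x v)"
    by (subst (asm) Ck.simps(2)) blast
  show ?case
    by (subst Ck.simps(2), rule exI[of _ "\<lambda>x v. L (f' x v)"])
      (auto intro: Suc.IH f' bounded_linear.has_derivative[OF assms])
qed

text \<open>With \<open>L\<close> the identity this restricts smoothness from \<open>UNIV\<close> to
  an arbitrary set \<open>S\<close>; with \<open>L = fst\<close> it turns a function of the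
  parameter into one of the pair (parameter, point).\<close>

lemma Ck_compose_linear:
  assumes "bounded_linear L"
  shows "Ck k UNIV f \<Longrightarrow> Ck k S (\<lambda>x. f (L x))"
proof (induction k arbitrary: f)
  case 0
  then have "continuous_on UNIV f" by simp
  then show ?case
    using continuous_on_compose2[of UNIV f S L] linear_continuous_on[OF assms] by simp
next
  case (Suc k)
  then obtain f' where f': "\<And>x. (f has_derivative f' x) (at x)" "\<And>v. Ck k UNIV (\<lambda>x. f' x v)"
    by (subst (asm) Ck.simps(2)) blast
  have "((\<lambda>x. f (L x)) has_derivative (\<lambda>v. f' (L x) (L v))) (at x)" for x
    using has_derivative_compose[OF bounded_linear_imp_has_derivative[OF assms] f'(1)] .
  then show ?case
    by (subst Ck.simps(2), intro exI[of _ "\<lambda>x v. f' (L x) (L v)"]) (auto intro: Suc.IH f')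
qed

lemma Ck_ident: "Ck k S (\<lambda>x. x)"
proof (cases k)
  case (Suc j)
  show ?thesis unfolding Suc
    by (subst Ck.simps(2), rule exI[of _ "\<lambda>_ v. v"]) (auto intro: Ck_const)
qed (simp add: continuous_on_id)

lemma Ck_add: "Ck k S f \<Longrightarrow> Ck k S g \<Longrightarrow> Ck k S (\<lambda>x. f x + g x)"
proof (induction k arbitrary: f g)
  case 0
  then show ?case by (simp add: continuous_on_add)
next
  case (Suc k)
  then obtain f' g' where *: "\<And>x. x \<in> S \<Longrightarrow> (f has_derivative f' x) (at x)" "\<And>v. Ck k S (\<lambda>x. f' x v)"
    "\<And>x. x \<in> S \<Longrightarrow> (g has_derivative g' x) (at x)" "\<And>v. Ck k S (\<lambda>x. g' x v)"
    by (subst (asm) (1 2) Ck.simps(2)) blast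
  show ?case
    by (subst Ck.simps(2), rule exI[of _ "\<lambda>x v. f' x v + g' x v"])
      (auto intro: Suc.IH * has_derivative_add)
qed

lemma Ck_sum: "(\<And>i. i \<in> A \<Longrightarrow> Ck k S (f i)) \<Longrightarrow> Ck k S (\<lambda>x. \<Sum>i\<in>A. f i x)"
  by (induction A rule: infinite_finite_induct) (auto intro: Ck_const Ck_add)

lemma Ck_bilinear:
  assumes "bounded_bilinear h"
  shows "Ck k S f \<Longrightarrow> Ck k S g \<Longrightarrow> Ck k S (\<lambda>x. h (f x) (g x))"
proof (induction k arbitrary: f g)
  case 0
  then show ?case using bounded_bilinear.continuous_on[OF assms] by simp
next
  case (Suc k)
  obtain f' g' where *: "\<And>x. x \<in> S \<Longrightarrow> (f has_derivative f' x) (at x)" "\<And>v. Ck k S (\<lambda>x. f' x v)"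
    "\<And>x. x \<in> S \<Longrightarrow> (g has_derivative g' x) (at x)" "\<And>v. Ck k S (\<lambda>x. g' x v)"
    using Suc.prems by (subst (asm) (1 2) Ck.simps(2)) blast
  note low = Suc.prems[THEN Ck_Suc_D]
  show ?case
    by (subst Ck.simps(2), rule exI[of _ "\<lambda>x v. h (f x) (g' x v) + h (f' x v) (g x)"])
      (auto intro!: Ck_add Suc.IH * low bounded_bilinear.FDERIV[OF assms])
qed

lemma Ck_minus: "Ck k S f \<Longrightarrow> Ck k S (\<lambda>x. - f x)"
  by (rule Ck_bounded_linear_compose[OF bounded_linear_minus[OF bounded_linear_ident]])

lemma Ck_diff: "Ck k S f \<Longrightarrow> Ck k S g \<Longrightarrow> Ck k S (\<lambda>x. f x - g x)"
  using Ck_add[OF _ Ck_minus, of k S f g] by simp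

lemma Ck_inner: "Ck k S f \<Longrightarrow> Ck k S g \<Longrightarrow> Ck k S (\<lambda>x. inner (f x) (g x))"
  by (rule Ck_bilinear[OF bounded_bilinear_inner])

lemma Ck_scaleR: "Ck k S f \<Longrightarrow> Ck k S g \<Longrightarrow> Ck k S (\<lambda>x. f x *\<^sub>R g x)"
  by (rule Ck_bilinear[OF bounded_bilinear_scaleR])

lemma Ck_mult: "Ck k S f \<Longrightarrow> Ck k S g \<Longrightarrow> Ck k S (\<lambda>x. f x * g x :: real)"
  by (rule Ck_bilinear[OF bounded_bilinear_mult])

text \<open>The derivative of \<open>r powr a\<close> is a multiple of
  \<open>r powr (a - 1)\<close>, so the induction runs over all exponents at once. The exponent -1/2
  later normalises vectors.\<close>

lemma Ck_powr:
  fixes f :: "'a::euclidean_space \<Rightarrow> real"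
  assumes pos: "\<And>x. x \<in> S \<Longrightarrow> f x > 0"
  shows "Ck k S f \<Longrightarrow> Ck k S (\<lambda>x. f x powr a)"
proof (induction k arbitrary: a)
  case 0
  then show ?case using pos by (force intro!: continuous_intros)
next
  case (Suc k)
  obtain f' where *: "\<And>x. x \<in> S \<Longrightarrow> (f has_derivative f' x) (at x)" "\<And>v. Ck k S (\<lambda>x. f' x v)"
    using Suc.prems by (subst (asm) Ck.simps(2)) blast
  have "((\<lambda>x. f x powr a) has_derivative (\<lambda>v. (a * f x powr (a - 1)) * f' x v)) (at x)" if "x \<in> S" for x
  proof -
    have "((\<lambda>r. r powr a) has_real_derivative a * f x powr (a - 1)) (at (f x))"
      using pos[OF that] by (rule has_real_derivative_powr)
    then have "((\<lambda>r. r powr a) has_derivative (*) (a * f x powr (a - 1))) (at (f x))"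
      by (rule has_field_derivative_imp_has_derivative)
    from has_derivative_compose[OF *(1)[OF that] this] show ?thesis .
  qed
  moreover have "Ck k S (\<lambda>x. (a * f x powr (a - 1)) * f' x v)" for v
    by (intro Ck_mult Ck_const Suc.IH Ck_Suc_D[OF Suc.prems] *)
  ultimately show ?case by (subst Ck.simps(2)) (intro exI[of _ "\<lambda>x v. (a * f x powr (a - 1)) * f' x v"]; blast)
qed

lemma bounded_linear_axis: "bounded_linear (axis i :: 'b::euclidean_space \<Rightarrow> 'b^'i::finite)"
  by (auto simp: linear_conv_bounded_linear[symmetric] vec_eq_iff axis_def intro!: linearI)

lemma vec_lambda_eq_sum_axis: "(\<chi> i. f i) = (\<Sum>i\<in>UNIV. axis i (f i))"
  for f :: "'i::finite \<Rightarrow> 'b::euclidean_space"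
  by (simp add: vec_eq_iff axis_def)

lemma Ck_vec_lambda:
  fixes f :: "'a::euclidean_space \<Rightarrow> 'i::finite \<Rightarrow> 'b::euclidean_space"
  assumes "\<And>i. Ck k S (\<lambda>x. f x i)"
  shows "Ck k S (\<lambda>x. \<chi> i. f x i)"
  unfolding vec_lambda_eq_sum_axis
  by (intro Ck_sum Ck_bounded_linear_compose[OF bounded_linear_axis] assms)

lemma Ck_vec_nth: "Ck k S f \<Longrightarrow> Ck k S (\<lambda>x. f x $ i)" for i :: "'i::finite"
  by (rule Ck_bounded_linear_compose[OF bounded_linear_vec_nth])

lemma linear_eq_sum_Basis:
  fixes L :: "'a::euclidean_space \<Rightarrow> 'b::real_normed_vector"
  assumes "linear L"
  shows "(\<Sum>b\<in>Basis. inner v b *\<^sub>R L b) = L v"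
  using linear_sum[OF assms, of "\<lambda>b. inner v b *\<^sub>R b" Basis] linear_cmul[OF assms]
  by (simp add: euclidean_representation)

text \<open>\<open>Ck\<close> speaks of one direction at a time, whereas transversality asks for
  operator-valued derivatives. In finite dimension these are assembled from their values on
  \<open>Basis\<close> and inherit differentiability and continuity.\<close>

lemma Ck_2_blinfun_derivatives:
  fixes f :: "'a::euclidean_space \<Rightarrow> 'b::euclidean_space"
  assumes "Ck 2 S f"
  obtains F1 :: "'a \<Rightarrow> 'a \<Rightarrow>\<^sub>L 'b" and F2 :: "'a \<Rightarrow> 'a \<Rightarrow>\<^sub>L 'a \<Rightarrow>\<^sub>L 'b" where
    "\<And>x. x \<in> S \<Longrightarrow> (f has_derivative blinfun_apply (F1 x)) (at x)"
    "\<And>x. x \<in> S \<Longrightarrow> (F1 has_derivative blinfun_apply (F2 x)) (at x)"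
    "continuous_on S F1" "continuous_on S F2"
proof -
  obtain f' where f': "\<And>x. x \<in> S \<Longrightarrow> (f has_derivative f' x) (at x)" "\<And>v. Ck (Suc 0) S (\<lambda>x. f' x v)"
    using assms unfolding numeral_2_eq_2 by (subst (asm) Ck.simps(2)) blast
  then have "\<forall>v. \<exists>f''. (\<forall>x\<in>S. ((\<lambda>x. f' x v) has_derivative f'' x) (at x)) \<and> (\<forall>w. continuous_on S (\<lambda>x. f'' x w))"
    by simp
  then obtain f'' where f'': "\<And>x v. x \<in> S \<Longrightarrow> ((\<lambda>x. f' x v) has_derivative f'' v x) (at x)"
    "\<And>v w. continuous_on S (\<lambda>x. f'' v x w)"
    by metis
  \<comment> \<open>\<open>h b y\<close> is the rank-one operator sending \<open>v\<close> to
    \<open>inner b v *\<^sub>R y\<close>; \<open>h2\<close> does the same with operators as values.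
    Both are linear in \<open>y\<close>, so they commute with differentiation in
    \<open>x\<close>.\<close>
  define h :: "'a \<Rightarrow> 'b \<Rightarrow> 'a \<Rightarrow>\<^sub>L 'b" where "h b y = blinfun_scaleR_left y o\<^sub>L blinfun_inner_left b" for b y
  have h_apply: "h b y v = inner b v *\<^sub>R y" for b y v
    by (simp add: h_def inner_commute)
  have h: "bounded_linear (h b)" for b
    unfolding linear_conv_bounded_linear[symmetric]
    by (rule linearI) (auto intro!: blinfun_eqI simp: h_apply blinfun.bilinear_simps scaleR_add_right)
  define h2 :: "'a \<Rightarrow> ('a \<Rightarrow>\<^sub>L 'b) \<Rightarrow> 'a \<Rightarrow>\<^sub>L 'a \<Rightarrow>\<^sub>L 'b"
    where "h2 b y = blinfun_scaleR_left y o\<^sub>L blinfun_inner_left b" for b y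
  have h2_apply: "h2 b y v = inner b v *\<^sub>R y" for b y v
    by (simp add: h2_def inner_commute)
  have h2: "bounded_linear (h2 b)" for b
    unfolding h2_def by (intro bounded_linear_intros)
  define F1 where "F1 x = (\<Sum>b\<in>Basis. h b (f' x b))" for x
  define F2 where "F2 x = (\<Sum>b\<in>Basis. h2 b (\<Sum>c\<in>Basis. h c (f'' c x b)))" for x
  have F1: "blinfun_apply (F1 x) = f' x" if "x \<in> S" for x
    using linear_eq_sum_Basis[OF has_derivative_linear[OF f'(1)[OF that]]]
    by (auto simp: F1_def blinfun.sum_left h_apply inner_commute)
  have F2: "blinfun_apply (F2 x) = (\<lambda>v. \<Sum>c\<in>Basis. h c (f'' c x v))" if "x \<in> S" for x
  proof
    fix v
    have "linear (\<lambda>v. \<Sum>c\<in>Basis. h c (f'' c x v))"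
      using f''(1)[OF that] h
      by (intro linear_compose_sum ballI bounded_linear.linear bounded_linear_compose[OF h] has_derivative_bounded_linear) auto
    from linear_eq_sum_Basis[OF this, of v]
    show "blinfun_apply (F2 x) v = (\<Sum>c\<in>Basis. h c (f'' c x v))"
      by (simp add: F2_def blinfun.sum_left h2_apply inner_commute)
  qed
  show thesis
  proof
    show "(f has_derivative blinfun_apply (F1 x)) (at x)" if "x \<in> S" for x
      using f'(1)[OF that] F1[OF that] by simp
    show "(F1 has_derivative blinfun_apply (F2 x)) (at x)" if "x \<in> S" for x
      unfolding F2[OF that] unfolding F1_def
      by (intro has_derivative_sum bounded_linear.has_derivative[OF h] f'' that)
    then show "continuous_on S F1"
      by (meson continuous_at_imp_continuous_on has_derivative_continuous)
    show "continuous_on S F2"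
      unfolding F2_def
      by (intro continuous_on_sum bounded_linear.continuous_on[OF h2] bounded_linear.continuous_on[OF h] f'')
  qed
qed

text \<open>Gram-Schmidt with parameters. That orthonormal families are left unchanged makes the
  derivative of the frame at the base point computable.\<close>

lemma smooth_Gram_Schmidt:
  fixes f :: "'a::euclidean_space \<Rightarrow> 'i \<Rightarrow> 'b::euclidean_space"
  assumes "finite A"
    and "\<And>k i. i \<in> A \<Longrightarrow> Ck k S (\<lambda>l. f l i)"
    and "\<And>l i. l \<in> S \<Longrightarrow> i \<in> A \<Longrightarrow> f l i \<notin> span (f l ` (A - {i}))"
  shows "\<exists>g. (\<forall>k. \<forall>i\<in>A. Ck k S (\<lambda>l. g l i)) \<and>
    (\<forall>l\<in>S. \<forall>i\<in>A. \<forall>j\<in>A. inner (g l i) (g l j) = (if i = j then 1 else 0)) \<and>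
    (\<forall>l\<in>S. span (g l ` A) = span (f l ` A)) \<and>
    (\<forall>l\<in>S. (\<forall>i\<in>A. \<forall>j\<in>A. inner (f l i) (f l j) = (if i = j then 1 else 0)) \<longrightarrow> (\<forall>i\<in>A. g l i = f l i))"
  using assms
proof (induction A)
  case empty
  show ?case by simp
next
  case (insert a A)
  have "f l i \<notin> span (f l ` (A - {i}))" if "l \<in> S" "i \<in> A" for l i
    using insert.prems(2)[of l i] that span_mono[of "f l ` (A - {i})" "f l ` (insert a A - {i})"] by blast
  then obtain g where
    g_Ck: "\<And>k i. i \<in> A \<Longrightarrow> Ck k S (\<lambda>l. g l i)"
    and g_on: "\<And>l i j. \<lbrakk>l \<in> S; i \<in> A; j \<in> A\<rbrakk> \<Longrightarrow> inner (g l i) (g l j) = (if i = j then 1 else 0)"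
    and g_span: "\<And>l. l \<in> S \<Longrightarrow> span (g l ` A) = span (f l ` A)"
    and g_eq: "\<And>l i. \<lbrakk>l \<in> S; \<forall>i\<in>A. \<forall>j\<in>A. inner (f l i) (f l j) = (if i = j then 1 else 0); i \<in> A\<rbrakk> \<Longrightarrow> g l i = f l i"
  proof -
    have "\<And>k i. i \<in> A \<Longrightarrow> Ck k S (\<lambda>l. f l i)" using insert.prems(1) by blast
    from insert.IH[OF this \<open>\<And>l i. l \<in> S \<Longrightarrow> i \<in> A \<Longrightarrow> f l i \<notin> span (f l ` (A - {i}))\<close>] that
    show ?thesis by blast
  qed
  \<comment> \<open>\<open>c l\<close> is the projection of the new vector onto the earlier ones,
    \<open>w l\<close> the remainder. The inverse length \<open>r l\<close> is a power of the
    squared length, hence smooth as \<open>w l\<close> never vanishes on \<open>S\<close>.\<close>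
  define c where "c l = (\<Sum>i\<in>A. inner (f l a) (g l i) *\<^sub>R g l i)" for l
  define w where "w l = f l a - c l" for l
  define r where "r l = inner (w l) (w l) powr (-1/2)" for l
  define g' where "g' l i = (if i = a then r l *\<^sub>R w l else g l i)" for l i
  have g'_A: "g' l i = g l i" if "i \<in> A" for l i
    using that insert.hyps by (auto simp: g'_def)
  have c_span: "c l \<in> span (g l ` A)" for l
    unfolding c_def by (intro span_sum span_scale span_base) auto
  have w_nz: "w l \<noteq> 0" if "l \<in> S" for l
    using c_span[of l] insert.prems(2)[OF that, of a] insert.hyps
    by (auto simp: w_def g_span[OF that])
  have r_pos: "r l > 0" if "l \<in> S" for l
    using w_nz[OF that] by (simp add: r_def)
  have c_perp: "inner (w l) (g l i) = 0" if "l \<in> S" "i \<in> A" for l i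
    using that insert.hyps by (simp add: w_def c_def inner_diff_left inner_sum_left g_on if_distrib cong: if_cong)
  have ww: "(r l * r l) * inner (w l) (w l) = 1" if "l \<in> S" for l
    using w_nz[OF that] by (simp add: r_def powr_add[symmetric] powr_minus_divide)
  have w_Ck: "Ck k S w" for k
    unfolding w_def c_def using insert.prems(1) g_Ck by (intro Ck_diff Ck_sum Ck_scaleR Ck_inner) auto
  have "Ck k S (\<lambda>l. r l *\<^sub>R w l)" for k
    unfolding r_def using w_nz by (intro Ck_scaleR Ck_powr Ck_inner w_Ck) auto
  then have 1: "\<forall>k. \<forall>i\<in>insert a A. Ck k S (\<lambda>l. g' l i)"
    using g_Ck by (auto simp: g'_A) (simp add: g'_def)
  have 2: "inner (g' l i) (g' l j) = (if i = j then 1 else 0)"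
    if "l \<in> S" "i \<in> insert a A" "j \<in> insert a A" for l i j
    using that g_on[of l i j] c_perp[of l i] c_perp[of l j] ww[of l]
    by (auto simp: g'_def inner_commute mult.assoc)
  have 3: "span (g' l ` insert a A) = span (f l ` insert a A)" if "l \<in> S" for l
  proof -
    have im: "g' l ` A = g l ` A" using g'_A by auto
    have wl: "g' l a = r l *\<^sub>R w l" by (simp add: g'_def)
    have "span (insert (w l) (g l ` A)) = span (insert (f l a) (g l ` A))"
      unfolding w_def
    proof (rule eq_span_insert_eq)
      show "f l a - c l - f l a \<in> span (g l ` A)" using c_span[of l] by (simp add: span_neg)
    qed
    moreover have "span (insert (r l *\<^sub>R w l) (g l ` A)) = span (insert (w l) (g l ` A))"
    proof -
      have "w l = (1 / r l) *\<^sub>R (r l *\<^sub>R w l)" using r_pos[OF that] by simp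
      then have "w l \<in> span (insert (r l *\<^sub>R w l) (g l ` A))"
        by (metis insertI1 span_base span_scale)
      then show ?thesis
        by (intro subset_antisym span_minimal) (auto intro: span_base span_scale)
    qed
    moreover have "span (insert (f l a) (g l ` A)) = span (insert (f l a) (f l ` A))"
      using g_span[OF that] by (simp add: span_insert)
    ultimately show ?thesis by (simp add: im wl)
  qed
  have 4: "g' l i = f l i" if l: "l \<in> S" and on: "\<forall>i\<in>insert a A. \<forall>j\<in>insert a A. inner (f l i) (f l j) = (if i = j then 1 else 0)"
    and i: "i \<in> insert a A" for l i
  proof -
    have gf: "g l j = f l j" if "j \<in> A" for j using g_eq[OF l _ that] on by auto
    have "c l = 0" unfolding c_def using gf on insert.hyps by (auto intro!: sum.neutral)
    then have "w l = f l a" "r l = 1" using on by (auto simp: w_def r_def)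
    then show ?thesis using gf i by (auto simp: g'_def)
  qed
  show ?case
    by (rule exI[of _ g']) (use 1 2 3 4 in blast)
qed

section \<open>Isotropic graphs\<close>

definition Jop :: "real^('n::finite + 'n) \<Rightarrow> real^('n + 'n)" where
  "Jop y = (\<chi> k. case k of Inl i \<Rightarrow> - y $ Inr i | Inr i \<Rightarrow> y $ Inl i)"

lemma sum_UNIV_sum_type: "(\<Sum>k\<in>UNIV. f k) = (\<Sum>i\<in>UNIV. f (Inl i)) + (\<Sum>i\<in>UNIV. f (Inr i))"
  for f :: "'a::finite + 'b::finite \<Rightarrow> 'c::comm_monoid_add"
  using sum.Plus[of "UNIV::'a set" "UNIV::'b set" f] by (simp add: UNIV_Plus_UNIV)

lemma symp_eq_inner_Jop: "symp x y = inner x (Jop y)"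
  by (simp add: symp_def Jop_def inner_vec_def sum_UNIV_sum_type sum_subtractf sum_negf)

lemma inner_Jop_skew: "inner (Jop x) y = - inner x (Jop y)"
  by (simp add: Jop_def inner_vec_def sum_UNIV_sum_type sum_negf)

lemma inner_Jop_Jop [simp]: "inner (Jop x) (Jop y) = inner x y"
  by (simp add: Jop_def inner_vec_def sum_UNIV_sum_type add.commute)

lemma Jop_Jop: "Jop (Jop x) = - x"
  by (simp add: Jop_def vec_eq_iff split: sum.split)

lemma linear_Jop: "linear Jop"
  by (rule linearI) (auto simp: Jop_def vec_eq_iff split: sum.split)

lemmas Jop_simps = linear_add[OF linear_Jop] linear_sum[OF linear_Jop] linear_cmul[OF linear_Jop]
  linear_diff[OF linear_Jop]

locale isotropic_frame =
  fixes e0 :: "(real^('n::finite + 'n))^'m::finite"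
  assumes orthonormal: "inner (e0 $ i) (e0 $ j) = (if i = j then 1 else 0)"
    and isotropic: "inner (e0 $ i) (Jop (e0 $ j)) = 0"
begin

text \<open>This is the tangent space of the isotropic Grassmannian at the span of
  \<open>e0\<close>: the symmetry condition is the linearisation of isotropy.\<close>

definition tangent :: "((real^('n + 'n))^'m) set" where
  "tangent = {A. \<forall>i j. inner (A $ i) (e0 $ j) = 0 \<and>
    inner (A $ i) (Jop (e0 $ j)) = inner (A $ j) (Jop (e0 $ i))}"

text \<open>The correction lies in the span of the vectors \<open>Jop (e0 $ j)\<close>, which is
  orthogonal to the base space. It repairs isotropy without changing the products with
  \<open>e0\<close>.\<close>

definition graph :: "(real^('n + 'n))^'m \<Rightarrow> (real^('n + 'n))^'m" where
  "graph A = (\<chi> i. e0 $ i + A $ i -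
    (\<Sum>j\<in>UNIV. (inner (A $ i) (Jop (A $ j)) / 2) *\<^sub>R Jop (e0 $ j)))"

text \<open>Removes the antisymmetric part of the matrix
  \<open>inner (g $ i) (Jop (e0 $ j))\<close>. This is the linear map that recovers the parameter
  from a frame.\<close>

definition tangent_part :: "(real^('n + 'n))^'m \<Rightarrow> (real^('n + 'n))^'m" where
  "tangent_part g = (\<chi> i. g $ i - (\<Sum>j\<in>UNIV.
    ((inner (g $ i) (Jop (e0 $ j)) - inner (g $ j) (Jop (e0 $ i))) / 2) *\<^sub>R Jop (e0 $ j)))"

lemma isotropic': "inner (Jop (e0 $ i)) (e0 $ j) = 0"
  by (simp add: inner_Jop_skew isotropic)

lemma sum_e0: "(\<Sum>k\<in>UNIV. c k * inner (e0 $ j) (e0 $ k)) = c j"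
  by (simp add: orthonormal if_distrib cong: if_cong)

lemma sum_e0': "(\<Sum>k\<in>UNIV. c k * inner (e0 $ k) (e0 $ j)) = c j"
  by (simp add: orthonormal if_distrib cong: if_cong)

lemma sum_e0_half:
  "(\<Sum>k\<in>UNIV. c k * inner (e0 $ j) (e0 $ k) / 2) = c j / 2"
  "(\<Sum>k\<in>UNIV. c k * inner (e0 $ k) (e0 $ j) / 2) = c j / 2"
  unfolding sum_divide_distrib[symmetric] sum_e0 sum_e0' by (rule refl)+

lemma subspace_tangent: "subspace tangent"
  unfolding tangent_def by (auto simp: subspace_def inner_add_left)

lemma linear_tangent_part: "linear tangent_part"
proof (rule linearI)
  fix x y and c :: real
  have "(inner ((x + y) $ i) (Jop (e0 $ j)) - inner ((x + y) $ j) (Jop (e0 $ i))) / 2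
    = (inner (x $ i) (Jop (e0 $ j)) - inner (x $ j) (Jop (e0 $ i))) / 2
    + (inner (y $ i) (Jop (e0 $ j)) - inner (y $ j) (Jop (e0 $ i))) / 2" for i j
    by (simp add: inner_add_left field_simps)
  then show "tangent_part (x + y) = tangent_part x + tangent_part y"
    by (simp only: tangent_part_def vec_eq_iff vec_lambda_beta vector_add_component scaleR_add_left sum.distrib) simp
  have "(inner ((c *\<^sub>R x) $ i) (Jop (e0 $ j)) - inner ((c *\<^sub>R x) $ j) (Jop (e0 $ i))) / 2
    = c * ((inner (x $ i) (Jop (e0 $ j)) - inner (x $ j) (Jop (e0 $ i))) / 2)" for i j
    by (simp add: algebra_simps)
  then show "tangent_part (c *\<^sub>R x) = c *\<^sub>R tangent_part x"
    by (simp only: tangent_part_def vec_eq_iff vec_lambda_beta vector_scaleR_component scaleR_scaleR[symmetric]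
      scaleR_sum_right[symmetric] scaleR_diff_right) simp
qed

lemma inner_graph_e0:
  assumes "A \<in> tangent"
  shows "inner (graph A $ i) (e0 $ j) = (if i = j then 1 else 0)"
  using assms by (simp add: graph_def tangent_def inner_add_left inner_diff_left inner_sum_left isotropic' orthonormal)

text \<open>The terms linear in \<open>A\<close> cancel by the symmetry in \<open>tangent\<close>.
  The quadratic term is \<open>2 * k i j\<close>, and each of the two pairings of a correction with
  \<open>e0\<close> contributes \<open>- k i j\<close>, as \<open>k\<close> is antisymmetric. All
  other pairings vanish.\<close>

lemma graph_isotropic:
  assumes A: "A \<in> tangent"
  shows "inner (graph A $ i) (Jop (graph A $ j)) = 0"
proof -
  have Ae: "inner (A $ i) (e0 $ j) = 0" for i j
    using A by (simp add: tangent_def)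
  then have Ae': "inner (e0 $ j) (A $ i) = 0" for i j
    by (simp add: inner_commute)
  have AJ: "inner (A $ i) (Jop (e0 $ j)) = inner (A $ j) (Jop (e0 $ i))" for i j
    using A by (auto simp: tangent_def)
  have eJA: "inner (e0 $ i) (Jop (A $ j)) = - inner (A $ j) (Jop (e0 $ i))" for i j
    by (metis inner_Jop_skew inner_commute)
  define k where "k i j = inner (A $ i) (Jop (A $ j)) / 2" for i j
  define s where "s i = (\<Sum>j\<in>UNIV. k i j *\<^sub>R Jop (e0 $ j))" for i
  have f: "graph A $ i = e0 $ i + A $ i - s i" for i
    by (simp add: graph_def s_def k_def)
  have es: "inner (e0 $ l) (s i) = 0" for l i
    by (simp add: s_def inner_sum_right isotropic)
  have "inner (e0 $ i) (Jop (s j)) = - k j i"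
    by (simp add: s_def Jop_simps Jop_Jop inner_sum_right sum_negf sum_e0)
  moreover have "inner (s i) (Jop (e0 $ j)) = k i j"
    by (simp add: s_def inner_sum_left sum_e0')
  moreover have "inner (A $ i) (Jop (s j)) = 0"
    by (simp add: s_def Jop_simps Jop_Jop inner_sum_right Ae)
  moreover have "inner (s i) (Jop (A $ j)) = 0"
    by (simp add: s_def inner_sum_left Ae')
  moreover have "inner (s i) (Jop (s j)) = 0"
  proof -
    have "inner (Jop (e0 $ l)) (Jop (s j)) = 0" for l by (simp add: es)
    then show ?thesis by (subst (1) s_def) (simp only: inner_sum_left inner_scaleR_left mult_zero_right sum.neutral_const)
  qed
  moreover have "k j i = - k i j"
    using inner_Jop_skew[of "A $ i" "A $ j"] inner_commute[of "A $ j" "Jop (A $ i)"] by (simp add: k_def)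
  moreover have "inner (A $ i) (Jop (A $ j)) = 2 * k i j"
    by (simp add: k_def)
  ultimately show ?thesis
    by (simp add: f Jop_simps inner_add_left inner_diff_left inner_add_right inner_diff_right isotropic eJA[of i j] AJ[of i j])
qed

text \<open>Since \<open>A\<close> has no antisymmetric part and its quadratic term is
  antisymmetric, what \<open>tangent_part\<close> removes is exactly the correction built into
  \<open>graph\<close>.\<close>

lemma tangent_part_graph:
  assumes A: "A \<in> tangent"
  shows "tangent_part (graph A - e0) = A"
proof -
  have AJ: "inner (A $ i) (Jop (e0 $ j)) = inner (A $ j) (Jop (e0 $ i))" for i j
    using A by (auto simp: tangent_def)
  have gJ: "inner (graph A $ i - e0 $ i) (Jop (e0 $ j)) = inner (A $ i) (Jop (e0 $ j)) - inner (A $ i) (Jop (A $ j)) / 2" for i j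
    by (simp add: graph_def inner_add_left inner_diff_left inner_sum_left sum_e0_half)
  have AJA: "inner (A $ j) (Jop (A $ i)) = - inner (A $ i) (Jop (A $ j))" for i j
    by (metis inner_Jop_skew inner_commute)
  have "inner (graph A $ i - e0 $ i) (Jop (e0 $ j)) - inner (graph A $ j - e0 $ j) (Jop (e0 $ i))
    = - inner (A $ i) (Jop (A $ j))" for i j
    unfolding gJ using AJ[of i j] AJA[of i j] by argo
  then show ?thesis
    unfolding tangent_part_def vec_eq_iff vector_minus_component
    by (simp add: sum_negf) (simp add: graph_def)
qed

text \<open>Isotropy of \<open>e0 + g\<close> forces
  \<open>inner (g $ i) (Jop (g $ j)) = - 2 * k i j\<close>. Passing from \<open>g\<close> to
  \<open>A\<close> adds only vectors in the \<open>Jop\<close>-image of the base space, which leaves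
  this product unchanged. So the correction in \<open>graph A\<close> restores what
  \<open>tangent_part\<close> removed.\<close>

lemma graph_tangent_part:
  assumes perp: "\<And>i j. inner (f $ i) (e0 $ j) = (if i = j then 1 else 0)"
    and iso: "\<And>i j. inner (f $ i) (Jop (f $ j)) = 0"
  shows "tangent_part (f - e0) \<in> tangent" "graph (tangent_part (f - e0)) = f"
proof -
  define g where "g = f - e0"
  have ge: "inner (g $ i) (e0 $ j) = 0" "inner (e0 $ j) (g $ i) = 0" for i j
    by (simp_all add: g_def inner_diff_left inner_diff_right perp orthonormal inner_commute[of "e0 $ j"])
  define k where "k i j = (inner (g $ i) (Jop (e0 $ j)) - inner (g $ j) (Jop (e0 $ i))) / 2" for i j
  define A where "A = tangent_part g"
  have A: "A $ i = g $ i - (\<Sum>j\<in>UNIV. k i j *\<^sub>R Jop (e0 $ j))" for i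
    by (simp add: A_def tangent_part_def k_def)
  have AJ: "inner (A $ i) (Jop (e0 $ j)) = (inner (g $ i) (Jop (e0 $ j)) + inner (g $ j) (Jop (e0 $ i))) / 2" for i j
    by (simp add: A inner_diff_left inner_sum_left sum_e0') (simp add: k_def field_simps)
  show "tangent_part (f - e0) \<in> tangent"
    unfolding g_def[symmetric] A_def[symmetric] tangent_def
  proof safe
    show "inner (A $ i) (e0 $ j) = 0" for i j
      using ge isotropic' by (simp add: A inner_diff_left inner_sum_left)
    show "inner (A $ i) (Jop (e0 $ j)) = inner (A $ j) (Jop (e0 $ i))" for i j
      by (simp add: AJ)
  qed
  have gJg: "inner (g $ i) (Jop (g $ j)) = - 2 * k i j" for i j
  proof -
    have "0 = inner (e0 $ i + g $ i) (Jop (e0 $ j + g $ j))"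
      using iso[of i j] by (simp add: g_def)
    also have "\<dots> = inner (e0 $ i) (Jop (g $ j)) + inner (g $ i) (Jop (e0 $ j)) + inner (g $ i) (Jop (g $ j))"
      by (simp add: Jop_simps inner_add_left inner_add_right isotropic)
    also have "inner (e0 $ i) (Jop (g $ j)) = - inner (g $ j) (Jop (e0 $ i))"
      by (metis inner_Jop_skew inner_commute)
    finally show ?thesis by (simp add: k_def)
  qed
  have "inner (A $ i) (Jop (A $ j)) = - 2 * k i j" for i j
    by (simp add: A Jop_simps inner_diff_left inner_diff_right inner_sum_left inner_sum_right Jop_Jop isotropic isotropic' ge gJg)
  then have "(inner (A $ i) (Jop (A $ j)) / 2) *\<^sub>R Jop (e0 $ j) = - (k i j *\<^sub>R Jop (e0 $ j))" for i j
    by simp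
  then have "graph A = e0 + g"
    by (simp add: graph_def vec_eq_iff A sum_negf)
  then show "graph (tangent_part (f - e0)) = f"
    by (simp add: A_def g_def)
qed

end

section \<open>Dimension of the parameter space\<close>

lemma dim_span_orthogonal_family:
  fixes b :: "'i \<Rightarrow> 'a::euclidean_space"
  assumes "finite I" and nz: "\<And>p. p \<in> I \<Longrightarrow> b p \<noteq> 0"
    and orth: "\<And>p q. p \<in> I \<Longrightarrow> q \<in> I \<Longrightarrow> p \<noteq> q \<Longrightarrow> inner (b p) (b q) = 0"
  shows "dim (span (b ` I)) = card I"
proof -
  have "inj_on b I"
    by (rule inj_onI) (metis inner_eq_zero_iff nz orth)
  moreover have "independent (b ` I)"
  proof (rule pairwise_orthogonal_independent)
    show "pairwise orthogonal (b ` I)"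
      unfolding pairwise_image using orth by (auto simp: pairwise_def orthogonal_def)
    show "0 \<notin> b ` I"
      using nz by force
  qed
  ultimately show ?thesis
    by (simp add: dim_eq_card_independent card_image)
qed

text \<open>\<open>to_nat\<close> serves as a linear order on the index type; the square consists of
  these pairs, their mirror images and the diagonal.\<close>

lemma card_less_pairs:
  "2 * card {(i, j). to_nat (i::'m::finite) < to_nat (j::'m)} + CARD('m) = CARD('m) * CARD('m)"
proof -
  let ?P = "{(i::'m, j::'m). to_nat i < to_nat j}"
  have "UNIV = ?P \<union> prod.swap ` ?P \<union> (\<lambda>i. (i, i)) ` UNIV"
    by (auto simp: image_iff inj_on_eq_iff[OF inj_to_nat] not_less order.order_iff_strict)
  then have "card (UNIV :: ('m \<times> 'm) set) = card (?P \<union> prod.swap ` ?P \<union> (\<lambda>i. (i, i)) ` UNIV)"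
    by simp
  also have "\<dots> = card ?P + card (prod.swap ` ?P) + card ((\<lambda>i::'m. (i, i)) ` UNIV)"
    by (subst card_Un_disjoint; (subst card_Un_disjoint)?) auto
  also have "card (prod.swap ` ?P) = card ?P"
    by (intro card_image) auto
  also have "card ((\<lambda>i::'m. (i, i)) ` UNIV) = CARD('m)"
    by (intro card_image) (auto intro: injI)
  finally show ?thesis by (simp add: card_cartesian_product flip: UNIV_Times_UNIV)
qed

lemma inner_axis_axis_vec: "inner (axis i x) (axis j y) = (if i = j then inner x y else 0)"
  for x y :: "'b::euclidean_space" and i j :: "'i::finite"
  by (simp add: inner_axis) (simp add: axis_def)

text \<open>\<open>tangent\<close> is the orthogonal complement of the constraint vectors
  \<open>W (i, j)\<close> for all pairs and \<open>Z (i, j)\<close> for one order of each pair of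
  distinct indices. They are nonzero and pairwise orthogonal, so they cost m^2 + m(m-1)/2 =
  m(3m-1)/2 dimensions out of 2nm.\<close>

lemma (in isotropic_frame) dim_tangent:
  "dim tangent = 2 * CARD('n) * CARD('m) - CARD('m) * (3 * CARD('m) - 1) div 2"
proof -
  define P where "P = {(i::'m, j::'m). to_nat i < to_nat j}"
  define W where "W = (\<lambda>(i::'m, j::'m). axis i (e0 $ j))"
  define Z where "Z = (\<lambda>(i::'m, j::'m). axis i (Jop (e0 $ j)) - axis j (Jop (e0 $ i)))"
  define b where "b = case_sum W Z"
  define I where "I = (UNIV :: ('m \<times> 'm) set) <+> P"
  have WW: "inner (W p) (W q) = (if p = q then 1 else 0)" for p q
    by (auto simp: W_def inner_axis_axis_vec orthonormal split: prod.split)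
  have WZ: "inner (W p) (Z q) = 0" "inner (Z q) (W p) = 0" for p q
    by (auto simp: W_def Z_def inner_axis_axis_vec isotropic isotropic' inner_diff_right inner_diff_left split: prod.split)
  have ZZ: "inner (Z p) (Z q) = (if p = q then 2 else 0)" if "p \<in> P" "q \<in> P" for p q
    using that
    by (auto simp: P_def Z_def inner_axis_axis_vec orthonormal inner_diff_right inner_diff_left split: if_splits)
  have "inner (b p) (b q) = 0" if "p \<in> I" "q \<in> I" "p \<noteq> q" for p q
    using that by (auto simp: I_def b_def WW WZ ZZ split: if_splits)
  moreover have "b p \<noteq> 0" if "p \<in> I" for p
    using that WW ZZ by (auto simp: I_def b_def) (metis inner_zero_left zero_neq_one, metis inner_zero_left zero_neq_numeral)
  ultimately have "dim (span (b ` I)) = card I"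
    by (intro dim_span_orthogonal_family) (auto simp: I_def)
  moreover have "tangent = {A \<in> UNIV. \<forall>x\<in>span (b ` I). orthogonal x A}"
  proof -
    have "A \<in> tangent \<longleftrightarrow> (\<forall>x\<in>span (b ` I). orthogonal x A)" for A
    proof -
    have "(\<forall>x\<in>span (b ` I). orthogonal x A) \<longleftrightarrow> (\<forall>p\<in>I. inner (b p) A = 0)"
    proof
      assume *: "\<forall>p\<in>I. inner (b p) A = 0"
      have "span (b ` I) \<subseteq> {x. orthogonal A x}"
        using * by (intro span_minimal subspace_orthogonal_to_vector) (auto simp: orthogonal_def inner_commute)
      then show "\<forall>x\<in>span (b ` I). orthogonal x A" by (auto simp: orthogonal_commute)
    qed (auto simp: orthogonal_def intro: span_base)
    also have "(\<forall>p\<in>I. inner (b p) A = 0) \<longleftrightarrow> (\<forall>p. inner (W p) A = 0) \<and> (\<forall>p\<in>P. inner (Z p) A = 0)"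
      by (auto simp: I_def b_def Plus_def ball_Un)
    also have "(\<forall>p. inner (W p) A = 0) \<longleftrightarrow> (\<forall>i j. inner (A $ i) (e0 $ j) = 0)"
    proof -
      have "inner (W (i, j)) A = inner (A $ i) (e0 $ j)" for i j
        by (simp add: W_def inner_axis' inner_commute[of "e0 $ j"])
      then show ?thesis by (simp add: split_paired_all)
    qed
    also have "(\<forall>p\<in>P. inner (Z p) A = 0) \<longleftrightarrow> (\<forall>i j. inner (A $ i) (Jop (e0 $ j)) = inner (A $ j) (Jop (e0 $ i)))"
    proof -
      have "inner (Z (i, j)) A = inner (A $ i) (Jop (e0 $ j)) - inner (A $ j) (Jop (e0 $ i))" for i j
        by (simp add: Z_def inner_diff_left inner_axis' inner_commute[of "Jop _"])
      then show ?thesis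
        unfolding P_def by simp (metis linorder_neqE_nat to_nat_split)
    qed
    finally show ?thesis by (auto simp: tangent_def)
    qed
    then show ?thesis by auto
  qed
  ultimately have *: "dim tangent + card I = DIM((real^('n + 'n))^'m)"
    using dim_subspace_orthogonal_to_vectors[of "span (b ` I)" UNIV] by simp
  have "card I = CARD('m) * CARD('m) + card P"
    unfolding I_def by (subst card_Plus) (auto simp: card_cartesian_product simp flip: UNIV_Times_UNIV)
  moreover have "DIM((real^('n + 'n))^'m) = 2 * CARD('n) * CARD('m)"
    by (simp add: card_UNIV_sum)
  moreover have "CARD('m) * (3 * CARD('m) - 1) div 2 = CARD('m) * CARD('m) + card P"
    using card_less_pairs[where 'm='m] unfolding P_def[symmetric] by (simp add: diff_mult_distrib2)
  ultimately show ?thesis using * by (simp add: algebra_simps)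
qed

section \<open>Gram determinants\<close>

lemma ker_of_det_0:
  fixes M :: "real^'k^'k::finite"
  assumes "det M = 0"
  obtains x where "x \<noteq> 0" "M *v x = 0"
  using assms matrix_left_invertible_ker[of M] invertible_left_inverse[of M] invertible_det_nz[of M] by auto

text \<open>Deform \<open>M\<close> to the identity along a segment. If \<open>det M\<close> were
  negative, the determinant would vanish at some \<open>s > 0\<close>; but a kernel vector
  \<open>x\<close> there would satisfy
  \<open>s * inner x x + (1 - s) * inner x (M *v x) = 0\<close>, with first term positive and second
  nonnegative.\<close>

lemma det_nonneg_of_psd:
  fixes M :: "real^'k^'k::finite"
  assumes psd: "\<And>x. inner x (M *v x) \<ge> 0"
  shows "det M \<ge> 0"
proof (rule ccontr)
  assume neg: "\<not> det M \<ge> 0"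
  define N where "N s = s *\<^sub>R mat 1 + (1 - s) *\<^sub>R M" for s
  have "continuous_on {0..1} (\<lambda>s. det (N s))"
    unfolding det_def N_def by (intro continuous_intros)
  moreover have "det (N 0) \<le> 0" "0 \<le> det (N 1)"
    using neg by (auto simp: N_def)
  ultimately obtain s where s: "0 \<le> s" "s \<le> 1" "det (N s) = 0"
    using IVT'[of "\<lambda>s. det (N s)" 0 0 1] by auto
  have "s \<noteq> 0" using s neg by (auto simp: N_def)
  obtain x where x: "x \<noteq> 0" "N s *v x = 0"
    using ker_of_det_0[OF s(3)] .
  have "N s *v x = s *\<^sub>R x + (1 - s) *\<^sub>R (M *v x)"
    by (simp add: N_def matrix_vector_mult_add_rdistrib scaleR_matrix_vector_assoc[symmetric])
  then have "0 = s * inner x x + (1 - s) * inner x (M *v x)"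
    using x(2) by (metis inner_add_right inner_scaleR_right inner_zero_right)
  moreover have "s * inner x x > 0"
    using x(1) s(1) \<open>s \<noteq> 0\<close> by simp
  moreover have "(1 - s) * inner x (M *v x) \<ge> 0"
    using psd s(2) by simp
  ultimately show False by linarith
qed

lemma matrix_mult_transpose_psd: "inner x ((D ** transpose D) *v x) \<ge> 0"
  for D :: "real^'a::finite^'b::finite"
  by (simp add: matrix_vector_mul_assoc[symmetric] dot_lmul_matrix[symmetric] transpose_matrix_vector)

text \<open>If \<open>D ** transpose D\<close> kills \<open>x\<close>, then the squared norm of
  \<open>transpose D *v x\<close> is zero. A vanishing Gram determinant thus yields a nonzero vector
  orthogonal to the range of \<open>D\<close>.\<close>

lemma transpose_ker_of_det_0:
  fixes D :: "real^'a::finite^'b::finite"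
  assumes "det (D ** transpose D) = 0"
  obtains x where "x \<noteq> 0" "transpose D *v x = 0"
proof -
  obtain x where x: "x \<noteq> 0" "(D ** transpose D) *v x = 0"
    using ker_of_det_0[OF assms] .
  have "inner x (D *v (transpose D *v x)) = 0"
    by (simp only: matrix_vector_mul_assoc x(2) inner_zero_right)
  then have "transpose D *v x = 0"
    by (simp add: dot_lmul_matrix[symmetric] transpose_matrix_vector)
  with x(1) show thesis by (rule that)
qed

section \<open>Orthogonal projections\<close>

lemma proj_eqI:
  assumes "subspace V" "y \<in> V" "\<And>v. v \<in> V \<Longrightarrow> inner (x - y) v = 0"
  shows "proj V x = y"
  unfolding proj_def
proof (rule the_equality)
  fix z assume z: "z \<in> V \<and> (\<forall>v\<in>V. inner (x - z) v = 0)"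
  have "y - z \<in> V" using assms z by (simp add: subspace_diff)
  then have "inner (x - z) (y - z) - inner (x - y) (y - z) = 0"
    using assms(3) z by simp
  then have "inner (y - z) (y - z) = 0" by (simp add: inner_diff_left)
  then show "z = y" by simp
qed (use assms in auto)

lemma proj_span_orthonormal:
  fixes e :: "'b::euclidean_space^'i::finite"
  assumes "\<And>i j. inner (e $ i) (e $ j) = (if i = j then 1 else 0)"
  shows "proj (span (range (\<lambda>i. e $ i))) x = (\<Sum>i\<in>UNIV. inner (e $ i) x *\<^sub>R e $ i)" (is "_ = ?y")
proof (rule proj_eqI)
  show "?y \<in> span (range (\<lambda>i. e $ i))"
    by (intro span_sum span_scale span_base) auto
  have "inner (x - ?y) (e $ j) = 0" for j
    by (simp add: inner_diff_left inner_sum_left assms inner_commute[of x] if_distrib cong: if_cong)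
  then have "span (range (\<lambda>i. e $ i)) \<subseteq> {v. orthogonal (x - ?y) v}"
    by (intro span_minimal subspace_orthogonal_to_vector) (auto simp: orthogonal_def)
  then show "inner (x - ?y) v = 0" if "v \<in> span (range (\<lambda>i. e $ i))" for v
    using that by (auto simp: orthogonal_def)
qed (rule subspace_span)

lemma ex_orthonormal_frame:
  fixes V :: "'b::euclidean_space set"
  assumes "subspace V" "dim V = CARD('i::finite)"
  obtains e :: "'b^'i" where
    "\<And>i j. inner (e $ i) (e $ j) = (if i = j then 1 else 0)" "span (range (\<lambda>i. e $ i)) = V"
proof -
  obtain B where B: "B \<subseteq> V" "pairwise orthogonal B" "\<And>x. x \<in> B \<Longrightarrow> norm x = 1" "independent B"
     "card B = dim V" "span B = V"
    using orthonormal_basis_subspace[OF assms(1)] by metis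
  have "finite B" using B(4) by (rule independent_imp_finite)
  then obtain h where h: "bij_betw h (UNIV :: 'i set) B"
    using B(5) assms(2) finite_same_card_bij[of "UNIV :: 'i set" B] by auto
  show thesis
  proof
    show "inner ((\<chi> i. h i) $ i) ((\<chi> i. h i) $ j) = (if i = j then 1 else 0)" for i j
      using h B(2,3) by (auto simp: bij_betw_def inj_on_def pairwise_def orthogonal_def image_def norm_eq_1) blast
    show "span (range (\<lambda>i. (\<chi> i. h i) $ i)) = V"
      using h B(6) by (simp add: bij_betw_def)
  qed
qed

text \<open>\<open>proj\<close> is a definite description, and \<open>matrix\<close> represents a
  map only if that map is linear. The expansion in an orthonormal basis settles both points.\<close>

lemma projmat_mult:
  fixes V :: "(real^'k::finite) set"
  assumes "subspace V"
  shows "projmat V *v x = proj V x" "proj V x \<in> V" "x \<in> V \<Longrightarrow> proj V x = x"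
proof -
  obtain B where B: "B \<subseteq> V" "pairwise orthogonal B" "\<And>x. x \<in> B \<Longrightarrow> norm x = 1" "independent B" "span B = V"
    using orthonormal_basis_subspace[OF assms] by metis
  have fin: "finite B" using B(4) by (rule independent_imp_finite)
  have P: "proj V x = (\<Sum>b\<in>B. inner b x *\<^sub>R b)" for x
  proof (rule proj_eqI[OF assms])
    show "(\<Sum>b\<in>B. inner b x *\<^sub>R b) \<in> V"
      unfolding B(5)[symmetric] by (intro span_sum span_scale span_base)
    have "inner (x - (\<Sum>b\<in>B. inner b x *\<^sub>R b)) c = 0" if "c \<in> B" for c
    proof -
      have "inner b c = (if b = c then 1 else 0)" if "b \<in> B" for b
        using B(2,3) that \<open>c \<in> B\<close> by (auto simp: pairwise_def orthogonal_def norm_eq_1)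
      then have "(\<Sum>b\<in>B. inner b x * inner b c) = (\<Sum>b\<in>B. if b = c then inner b x else 0)"
        by (intro sum.cong) auto
      then show ?thesis using fin that
        by (simp add: inner_diff_left inner_sum_left inner_commute[of x])
    qed
    then have "span B \<subseteq> {v. orthogonal (x - (\<Sum>b\<in>B. inner b x *\<^sub>R b)) v}"
      by (intro span_minimal subspace_orthogonal_to_vector) (auto simp: orthogonal_def)
    then show "inner (x - (\<Sum>b\<in>B. inner b x *\<^sub>R b)) v = 0" if "v \<in> V" for v
      using that B(5) by (auto simp: orthogonal_def)
  qed
  have "linear (proj V)"
    by (rule linearI) (simp_all add: P inner_add_right scaleR_add_left sum.distrib scaleR_sum_right)
  then show "projmat V *v x = proj V x"
    unfolding projmat_def by (simp add: matrix_works linear_matrix_vector_mul_eq)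
  show "proj V x \<in> V"
    unfolding P unfolding B(5)[symmetric] by (intro span_sum span_scale span_base)
  show "x \<in> V \<Longrightarrow> proj V x = x"
    by (rule proj_eqI[OF assms]) auto
qed

lemma bounded_bilinear_matrix_vector_mult:
  "bounded_bilinear ((*v) :: real^'a::finite^'b::finite \<Rightarrow> real^'a \<Rightarrow> real^'b)"
  unfolding bilinear_conv_bounded_bilinear[symmetric] bilinear_def
  by (intro conjI allI linearI)
    (simp_all add: matrix_vector_mult_add_rdistrib scaleR_matrix_vector_assoc matrix_vector_mult_scaleR
      matrix_vector_right_distrib)

lemma dim_span_orthonormal:
  fixes e :: "'b::euclidean_space^'i::finite"
  assumes "\<And>i j. inner (e $ i) (e $ j) = (if i = j then 1 else 0)"
  shows "dim (span (range (\<lambda>i. e $ i))) = CARD('i)"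
  using assms by (intro dim_span_orthogonal_family) (auto, metis inner_zero_left zero_neq_one)

lemma mem_subspace_iff_projmat: "subspace V \<Longrightarrow> x \<in> V \<longleftrightarrow> projmat V *v x = x"
  by (metis projmat_mult)

lemma subspace_eq_of_projmat_eq:
  assumes "subspace V" "subspace W" "projmat V = projmat W"
  shows "V = W"
  using mem_subspace_iff_projmat assms by (metis subsetI subset_antisym)

lemma continuous_on_projmat_frame:
  fixes e :: "'a::topological_space \<Rightarrow> (real^'k::finite)^'i::finite"
  assumes cont: "continuous_on S e"
    and on: "\<And>l i j. l \<in> S \<Longrightarrow> inner (e l $ i) (e l $ j) = (if i = j then 1 else 0)"
  shows "continuous_on S (\<lambda>l. projmat (span (range (\<lambda>i. e l $ i))))"
proof -
  have "continuous_on S (\<lambda>l. \<chi> a b. (\<Sum>i\<in>UNIV. inner (e l $ i) (axis b 1) *\<^sub>R e l $ i) $ a)"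
    by (simp, intro continuous_intros cont)
  moreover have "projmat (span (range (\<lambda>i. e l $ i))) = (\<chi> a b. (\<Sum>i\<in>UNIV. inner (e l $ i) (axis b 1) *\<^sub>R e l $ i) $ a)"
    if "l \<in> S" for l
    using on[OF that] by (simp add: projmat_def matrix_def proj_span_orthonormal)
  ultimately show ?thesis by (simp cong: continuous_on_cong)
qed

lemma norm_vec_le_sum: "norm x \<le> (\<Sum>i\<in>UNIV. norm (x $ i))" for x :: "'b::real_normed_vector^'i::finite"
  by (simp add: norm_vec_def L2_set_le_sum)

section \<open>The chart\<close>

context isotropic_frame
begin

definition span_graph :: "(real^('n + 'n))^'m \<Rightarrow> (real^('n + 'n)) set" where
  "span_graph A = span (range (\<lambda>i. graph A $ i))"

text \<open>The vectors \<open>e0 $ j\<close> pair with the vectors \<open>graph A $ i\<close> like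
  a dual basis, so products with them read off coordinates.\<close>

lemma span_graph_expand:
  assumes "A \<in> tangent" "x \<in> span_graph A"
  shows "(\<Sum>j\<in>UNIV. inner x (e0 $ j) *\<^sub>R graph A $ j) = x"
proof -
  have "graph A $ i = (\<Sum>j\<in>UNIV. inner (graph A $ i) (e0 $ j) *\<^sub>R graph A $ j)" for i
    by (simp add: inner_graph_e0[OF assms(1)] if_distrib[of "\<lambda>c. c *\<^sub>R _"] cong: if_cong)
  then have "span_graph A \<subseteq> {x. (\<Sum>j\<in>UNIV. inner x (e0 $ j) *\<^sub>R graph A $ j) = x}"
    unfolding span_graph_def
    by (intro span_minimal subspaceI)
      (auto simp: inner_add_left scaleR_add_left sum.distrib simp flip: scaleR_scaleR scaleR_sum_right)
  then show ?thesis using assms(2) by auto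
qed

lemma graph_in_span_graph: "graph A $ i \<in> span_graph A"
  unfolding span_graph_def by (rule span_base) simp

lemma span_graph_inj:
  assumes "A \<in> tangent" "B \<in> tangent" "span_graph A = span_graph B"
  shows "A = B"
proof -
  have "graph A $ i = graph B $ i" for i
    using span_graph_expand[OF assms(2), of "graph A $ i"] graph_in_span_graph[of A i] assms(3)
    by (simp add: inner_graph_e0[OF assms(1)] if_distrib[of "\<lambda>c. c *\<^sub>R _"] cong: if_cong)
  then have "graph A = graph B" by (simp add: vec_eq_iff)
  then show ?thesis using tangent_part_graph assms(1,2) by metis
qed

lemma graph_notin_span:
  assumes "A \<in> tangent"
  shows "graph A $ i \<notin> span ((\<lambda>i. graph A $ i) ` (UNIV - {i}))"
proof
  assume *: "graph A $ i \<in> span ((\<lambda>i. graph A $ i) ` (UNIV - {i}))"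
  have "span ((\<lambda>i. graph A $ i) ` (UNIV - {i})) \<subseteq> {x. orthogonal (e0 $ i) x}"
    by (intro span_minimal subspace_orthogonal_to_vector)
      (auto simp: orthogonal_def inner_graph_e0[OF assms] inner_commute[of "e0 $ i"])
  with * show False
    by (auto simp: orthogonal_def inner_graph_e0[OF assms] inner_commute[of "e0 $ i"])
qed

lemma isotropic_span_graph:
  assumes "A \<in> tangent"
  shows "Defs.isotropic (span_graph A)"
  unfolding Defs.isotropic_def symp_eq_inner_Jop
proof (intro ballI)
  fix v w assume "v \<in> span_graph A" "w \<in> span_graph A"
  then have v: "v = (\<Sum>j\<in>UNIV. inner v (e0 $ j) *\<^sub>R graph A $ j)" and w: "w = (\<Sum>j\<in>UNIV. inner w (e0 $ j) *\<^sub>R graph A $ j)"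
    using span_graph_expand[OF assms] by metis+
  show "inner v (Jop w) = 0"
    by (subst v, subst w) (simp add: Jop_simps inner_sum_left inner_sum_right graph_isotropic[OF assms])
qed

text \<open>If \<open>P\<close> and \<open>P'\<close> are the projections onto \<open>span_graph A\<close> and \<open>V\<close>, then
  for \<open>y \<in> V\<close> the vector \<open>P y\<close> is close to \<open>y = P' y\<close> and is
  controlled by its products with the frame. Hence \<open>V\<close> is itself a graph over the base space,
  and its frame is close to that of \<open>A\<close>.\<close>

lemma span_graph_nearby:
  assumes A: "A \<in> tangent" and "\<delta> > 0"
  shows "\<exists>\<epsilon>>0. \<forall>V\<in>iso_grass CARD('m). norm (projmat V - projmat (span_graph A)) < \<epsilon> \<longrightarrow>
    (\<exists>B\<in>tangent. norm (B - A) < \<delta> \<and> V = span_graph B)"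
proof -
  define f where "f i = graph A $ i" for i
  define C where "C = (\<Sum>i\<in>UNIV. norm (f i))"
  have "C \<ge> 0" by (simp add: C_def sum_nonneg)
  obtain L where L: "L > 0" "\<And>x. norm (tangent_part x) \<le> L * norm x"
    using linear_bounded_pos[OF linear_tangent_part] by blast
  obtain K where K: "K > 0" "\<And>(M :: real^('n+'n)^('n+'n)) x. norm (M *v x) \<le> norm M * norm x * K"
    using bounded_bilinear.pos_bounded[OF bounded_bilinear_matrix_vector_mult[where 'a="'n+'n" and 'b="'n+'n"]] by blast
  \<comment> \<open>The first bound makes the error in \<open>dist_f\<close> at most half the length
    of \<open>y\<close>, so that \<open>y\<close> is controlled by its coordinates; the second
    brings the final estimate for \<open>B - A\<close> below \<open>\<delta>\<close>.\<close>
  define \<eta> where "\<eta> = min (1 / (2 * (C + 1))) (\<delta> / (2 * L * (C + 1) * (C + 1)))"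
  have "\<eta> > 0" using \<open>C \<ge> 0\<close> \<open>\<delta> > 0\<close> L(1) by (simp add: \<eta>_def)
  have eta1: "\<eta> * (C + 1) \<le> 1 / 2"
  proof -
    have "\<eta> * (C + 1) \<le> 1 / (2 * (C + 1)) * (C + 1)"
      using \<open>C \<ge> 0\<close> by (intro mult_right_mono) (auto simp: \<eta>_def)
    also have "\<dots> = 1 / 2" using \<open>C \<ge> 0\<close> by (simp add: field_simps)
    finally show ?thesis .
  qed
  have eta2: "L * (2 * \<eta> * (C + 1) * C) < \<delta>"
  proof -
    have "L * (2 * \<eta> * (C + 1) * C) < L * (2 * \<eta> * (C + 1) * (C + 1))"
      using \<open>C \<ge> 0\<close> L(1) \<open>\<eta> > 0\<close> by (intro mult_strict_left_mono) auto
    also have "\<dots> = \<eta> * (2 * L * (C + 1) * (C + 1))" by simp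
    also have "\<dots> \<le> \<delta> / (2 * L * (C + 1) * (C + 1)) * (2 * L * (C + 1) * (C + 1))"
      using \<open>C \<ge> 0\<close> L(1) by (intro mult_right_mono) (auto simp: \<eta>_def)
    also have "\<dots> = \<delta>" using \<open>C \<ge> 0\<close> L(1) by simp
    finally show ?thesis .
  qed
  show ?thesis
  proof (intro exI[of _ "\<eta> / K"] conjI ballI impI)
    show "\<eta> / K > 0" using \<open>\<eta> > 0\<close> K(1) by simp
    fix V :: "(real^('n + 'n)) set"
    assume V: "V \<in> iso_grass CARD('m)" and near: "norm (projmat V - projmat (span_graph A)) < \<eta> / K"
    have sub: "subspace V" "dim V = CARD('m)" "Defs.isotropic V" using V by (auto simp: iso_grass_def)
    define P where "P y = projmat (span_graph A) *v y" for y
    have P_mem: "P y \<in> span_graph A" for y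
      unfolding P_def by (simp add: projmat_mult span_graph_def)
    have P_near: "norm (P y - y) \<le> \<eta> * norm y" if "y \<in> V" for y
    proof -
      have "projmat V *v y = y" using mem_subspace_iff_projmat[OF sub(1)] that by simp
      then have "norm (P y - y) = norm ((projmat V - projmat (span_graph A)) *v y)"
        by (simp add: P_def matrix_vector_mult_diff_rdistrib norm_minus_commute)
      also have "\<dots> \<le> norm (projmat V - projmat (span_graph A)) * norm y * K" by (rule K(2))
      also have "\<dots> \<le> \<eta> / K * norm y * K"
        using near K(1) by (intro mult_right_mono) auto
      finally show ?thesis using K(1) by simp
    qed
    have "norm (e0 $ j) = 1" for j by (simp add: norm_eq_1 orthonormal)
    then have P_inner: "\<bar>inner (P y - y) (e0 $ j)\<bar> \<le> \<eta> * norm y" if "y \<in> V" for y j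
      using Cauchy_Schwarz_ineq2[of "P y - y" "e0 $ j"] P_near[OF that] by simp
    have dist_f: "norm (y - (\<Sum>j\<in>UNIV. inner y (e0 $ j) *\<^sub>R f j)) \<le> \<eta> * (C + 1) * norm y" if "y \<in> V" for y
    proof -
      have "P y = (\<Sum>j\<in>UNIV. inner (P y) (e0 $ j) *\<^sub>R f j)"
        using span_graph_expand[OF A P_mem] by (simp add: f_def)
      then have "P y - (\<Sum>j\<in>UNIV. inner y (e0 $ j) *\<^sub>R f j) = (\<Sum>j\<in>UNIV. inner (P y - y) (e0 $ j) *\<^sub>R f j)"
        by (simp add: inner_diff_left scaleR_diff_left sum_subtractf)
      also have "norm \<dots> \<le> (\<Sum>j\<in>UNIV. \<bar>inner (P y - y) (e0 $ j)\<bar> * norm (f j))"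
        by (rule order_trans[OF norm_sum]) simp
      also have "\<dots> \<le> (\<Sum>j\<in>UNIV. (\<eta> * norm y) * norm (f j))"
        by (intro sum_mono mult_right_mono P_inner that) auto
      also have "\<dots> = \<eta> * norm y * C" by (simp add: C_def sum_distrib_left)
      finally have "norm (P y - (\<Sum>j\<in>UNIV. inner y (e0 $ j) *\<^sub>R f j)) \<le> \<eta> * norm y * C" .
      with P_near[OF that] norm_triangle_ineq4[of "P y - (\<Sum>j\<in>UNIV. inner y (e0 $ j) *\<^sub>R f j)" "P y - y"]
      show ?thesis by (simp add: algebra_simps)
    qed
    have bound: "norm y \<le> 2 * norm (\<Sum>j\<in>UNIV. inner y (e0 $ j) *\<^sub>R f j)" if "y \<in> V" for y
    proof -
      have "\<eta> * (C + 1) * norm y \<le> 1 / 2 * norm y" by (intro mult_right_mono eta1) simp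
      then show ?thesis
        using dist_f[OF that] norm_triangle_ineq2[of y "\<Sum>j\<in>UNIV. inner y (e0 $ j) *\<^sub>R f j"] by simp
    qed
    \<comment> \<open>\<open>T\<close> records the products with \<open>e0\<close>. By
      \<open>bound\<close> it is injective on \<open>V\<close>, hence onto by equality of
      dimensions. The preimages of the axis vectors form a frame of \<open>V\<close> dual to
      \<open>e0\<close>, as \<open>graph_tangent_part\<close> demands.\<close>
    define T where "T y = (\<chi> j. inner y (e0 $ j))" for y :: "real^('n + 'n)"
    have T: "linear T" by (rule linearI) (auto simp: T_def vec_eq_iff inner_add_left)
    have T0: "y = 0" if "y \<in> V" "T y = 0" for y
      using bound[OF that(1)] that(2) by (simp add: T_def vec_eq_iff)
    have "inj_on T V"
      using linear_inj_on_iff_eq_0[OF T sub(1)] T0 by blast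
    then have "dim (T ` V) = CARD('m)"
      using dim_image_eq[OF T] sub by (simp add: span_eq_iff[THEN iffD2])
    then have "T ` V = UNIV"
      using dim_eq_full[of "T ` V"] linear_subspace_image[OF T sub(1)] by (simp add: span_eq_iff[THEN iffD2])
    then have "\<exists>y\<in>V. T y = axis i 1" for i
      by (metis UNIV_I image_iff)
    then obtain g where g: "\<And>i. g i \<in> V" "\<And>i. T (g i) = axis i 1" by metis
    define f' where "f' = (\<chi> i. g i)"
    have f'_e0: "inner (f' $ i) (e0 $ j) = (if i = j then 1 else 0)" for i j
      using g(2)[of i] by (auto simp: T_def f'_def vec_eq_iff axis_def)
    have f'_iso: "inner (f' $ i) (Jop (f' $ j)) = 0" for i j
      using sub(3) g(1) by (simp add: Defs.isotropic_def symp_eq_inner_Jop f'_def)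
    define B where "B = tangent_part (f' - e0)"
    have B: "B \<in> tangent" "graph B = f'"
      unfolding B_def using graph_tangent_part[OF f'_e0 f'_iso] by auto
    have sum_f: "(\<Sum>j\<in>UNIV. inner (f' $ i) (e0 $ j) *\<^sub>R f j) = f i" for i
      by (simp add: f'_e0 if_distrib[of "\<lambda>c. c *\<^sub>R _"] cong: if_cong)
    have "norm (f' $ i - f i) \<le> 2 * \<eta> * (C + 1) * norm (f i)" for i
    proof -
      have mem: "f' $ i \<in> V" by (simp add: f'_def g)
      have "norm (f' $ i - f i) \<le> \<eta> * (C + 1) * norm (f' $ i)"
        using dist_f[OF mem] by (simp only: sum_f)
      also have "\<dots> \<le> \<eta> * (C + 1) * (2 * norm (f i))"
        using bound[OF mem] \<open>\<eta> > 0\<close> \<open>C \<ge> 0\<close> by (intro mult_left_mono) (simp_all only: sum_f, simp)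
      finally show ?thesis by simp
    qed
    then have "(\<Sum>i\<in>UNIV. norm ((f' - graph A) $ i)) \<le> (\<Sum>i\<in>UNIV. 2 * \<eta> * (C + 1) * norm (f i))"
      by (intro sum_mono) (simp add: f_def)
    then have "norm (f' - graph A) \<le> 2 * \<eta> * (C + 1) * C"
      using norm_vec_le_sum[of "f' - graph A"] by (simp add: C_def sum_distrib_left)
    moreover have "B - A = tangent_part (f' - graph A)"
      using tangent_part_graph[OF A] tangent_part_graph[OF B(1)] B(2)
        linear_diff[OF linear_tangent_part, of "f' - e0" "graph A - e0"] by simp
    ultimately have "norm (B - A) \<le> L * (2 * \<eta> * (C + 1) * C)"
      using order_trans[OF L(2)[of "f' - graph A"] mult_left_mono[OF _ less_imp_le[OF L(1)]]] by simp
    then have "norm (B - A) < \<delta>" using eta2 by simp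
    moreover have "V = span_graph B"
    proof
      show "span_graph B \<subseteq> V"
        unfolding span_graph_def B(2) by (intro span_minimal sub(1)) (auto simp: f'_def g)
      show "V \<subseteq> span_graph B"
      proof
        fix y assume y: "y \<in> V"
        define z where "z = (\<Sum>j\<in>UNIV. inner y (e0 $ j) *\<^sub>R f' $ j)"
        have "z \<in> span_graph B"
          unfolding z_def span_graph_def B(2) by (intro span_sum span_scale span_base) auto
        moreover have "y - z \<in> V"
          using y \<open>z \<in> span_graph B\<close> \<open>span_graph B \<subseteq> V\<close> sub(1) by (auto intro: subspace_diff)
        moreover have "T (y - z) = 0"
          by (simp add: T_def vec_eq_iff z_def inner_diff_left inner_sum_left f'_e0 if_distrib cong: if_cong)
        ultimately show "y \<in> span_graph B" using T0[of "y - z"] by simp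
      qed
    qed
    ultimately show "\<exists>B\<in>tangent. norm (B - A) < \<delta> \<and> V = span_graph B"
      using B(1) by blast
  qed
qed

lemma tangent_transversal:
  fixes t :: "real^'m"
  assumes u: "norm u = 1" "\<And>i. inner (e0 $ i) u = 0" and "t \<noteq> 0"
  shows "\<exists>A\<in>tangent. (\<Sum>i\<in>UNIV. t $ i * inner (A $ i) u) \<noteq> 0"
proof -
  define c where "c i = inner u (Jop (e0 $ i))" for i
  define A :: "(real^('n + 'n))^'m"
    where "A = (\<chi> i. t $ i *\<^sub>R u + c i *\<^sub>R (\<Sum>j\<in>UNIV. t $ j *\<^sub>R Jop (e0 $ j)))"
  \<comment> \<open>The second summand of \<open>A\<close> makes these products symmetric in
    \<open>i\<close> and \<open>k\<close>, which puts \<open>A\<close> into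
    \<open>tangent\<close>.\<close>
  have "inner (A $ i) (Jop (e0 $ k)) = t $ i * c k + c i * t $ k" for i k
    by (simp add: A_def inner_add_left inner_sum_left sum_e0' c_def)
  moreover have "inner (A $ i) (e0 $ k) = 0" for i k
    using u(2)[of k] by (simp add: A_def inner_add_left inner_sum_left isotropic' inner_commute[of u])
  ultimately have "A \<in> tangent" by (simp add: tangent_def)
  moreover have "(\<Sum>i\<in>UNIV. t $ i * inner (A $ i) u) > 0"
  proof -
    have "inner u u = 1" using u(1) by (simp add: norm_eq_1)
    then have "inner (A $ i) u = t $ i + c i * (\<Sum>j\<in>UNIV. t $ j * c j)" for i
      by (simp add: A_def inner_add_left inner_sum_left c_def inner_commute[of "Jop _" u])
    then have "(\<Sum>i\<in>UNIV. t $ i * inner (A $ i) u) = (\<Sum>i\<in>UNIV. t $ i * t $ i + (t $ i * c i) * (\<Sum>j\<in>UNIV. t $ j * c j))"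
      by (simp add: algebra_simps)
    also have "\<dots> = inner t t + (\<Sum>j\<in>UNIV. t $ j * c j) * (\<Sum>j\<in>UNIV. t $ j * c j)"
      by (simp add: sum.distrib inner_vec_def flip: sum_distrib_right)
    also have "\<dots> > 0" using \<open>t \<noteq> 0\<close> by (intro add_pos_nonneg) auto
    finally show ?thesis .
  qed
  ultimately show ?thesis by force
qed

end

section \<open>Transversality\<close>

text \<open>For an orthonormal frame \<open>y\<close> this is the projection onto its span, in the
  coordinates of the frame. It is bilinear, so parameter derivatives and their bounds come from
  those of the frame alone.\<close>

definition frame_coords :: "'b::euclidean_space^'m::finite \<Rightarrow> 'b \<Rightarrow> real^'m" where
  "frame_coords y x = (\<chi> i. inner (y $ i) x)"

lemma bounded_bilinear_frame_coords:
  "bounded_bilinear (frame_coords :: 'b::euclidean_space^'m::finite \<Rightarrow> 'b \<Rightarrow> real^'m)"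
  unfolding bilinear_conv_bounded_bilinear[symmetric] bilinear_def
  by (intro conjI allI linearI) (simp_all add: frame_coords_def vec_eq_iff inner_add_left inner_add_right)

interpretation frame_coords: bounded_bilinear "frame_coords :: 'b::euclidean_space^'m::finite \<Rightarrow> 'b \<Rightarrow> real^'m"
  by (rule bounded_bilinear_frame_coords)

text \<open>Condition (3) is only needed in the sharp form \<open>nondeg\<close> at the base point:
  \<open>\<parallel>\<Phi>\<parallel>\<^sup>2 + det (D\<Phi> D\<Phi>\<^sup>T)\<close> depends only on the parameter and on the unit vector
  in the direction of \<open>x - y\<close>, so by compactness of the sphere it stays
  bounded away from 0 for all parameters near the base point.\<close>

lemma transversal_near_nondegenerate:
  fixes e :: "real^'p::finite \<Rightarrow> (real^'N::finite)^'m::finite"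
  assumes e: "Ck 2 UNIV e"
    and e0: "(e has_derivative e') (at 0)"
    and nondeg: "\<And>u t. norm u = 1 \<Longrightarrow> (\<And>i. inner (e 0 $ i) u = 0) \<Longrightarrow> t \<noteq> 0 \<Longrightarrow>
      \<exists>v. (\<Sum>i\<in>UNIV. t $ i * inner (e' v $ i) u) \<noteq> 0"
  shows "\<exists>r>0. transversal (ball 0 r) (\<lambda>l x. \<chi> i. inner (e l $ i) x)"
proof -
  obtain F1 F2 where F1: "\<And>l. (e has_derivative blinfun_apply (F1 l)) (at l)"
    and F2: "\<And>l. (F1 has_derivative blinfun_apply (F2 l)) (at l)"
    and cont: "continuous_on UNIV F1" "continuous_on UNIV F2"
    by (rule Ck_2_blinfun_derivatives[OF e], rule that) auto
  have e'_eq: "e' = blinfun_apply (F1 0)"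
    using has_derivative_unique[OF e0 F1] .
  define B where "B x = Blinfun (\<lambda>y :: (real^'N)^'m. frame_coords y x)" for x
  have B_apply: "blinfun_apply (B x) = (\<lambda>y. frame_coords y x)" for x
    unfolding B_def by (rule bounded_linear_Blinfun_apply[OF frame_coords.bounded_linear_left])
  obtain K where K: "K > 0" "\<And>(y :: (real^'N)^'m) x. norm (frame_coords y x) \<le> norm y * norm x * K"
    using frame_coords.pos_bounded by blast
  have B_norm: "norm (B x) \<le> K * norm x" for x
    using K by (intro norm_blinfun_bound) (auto simp: B_apply mult_ac)
  define D1 where "D1 l x = B x o\<^sub>L F1 l" for l x
  define D2 where "D2 l x = Blinfun (\<lambda>v. B x o\<^sub>L blinfun_apply (F2 l) v)" for l x
  have D2_apply: "blinfun_apply (D2 l x) = (\<lambda>v. B x o\<^sub>L blinfun_apply (F2 l) v)" for l x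
    unfolding D2_def by (rule bounded_linear_Blinfun_apply) (intro bounded_linear_intros)
  have D1: "((\<lambda>l. frame_coords (e l) x) has_derivative blinfun_apply (D1 l x)) (at l)" for l x
  proof -
    have "((\<lambda>l. frame_coords (e l) x) has_derivative (\<lambda>v. frame_coords (F1 l v) x)) (at l)"
      by (rule bounded_linear.has_derivative[OF frame_coords.bounded_linear_left F1])
    then show ?thesis by (simp add: D1_def B_apply blinfun_compose.rep_eq comp_def)
  qed
  have D2: "((\<lambda>l. D1 l x) has_derivative blinfun_apply (D2 l x)) (at l)" for l x
    unfolding D1_def D2_apply
    by (rule bounded_linear.has_derivative[OF _ F2]) (intro bounded_linear_intros)
  obtain M1 M2 where M: "\<And>l. l \<in> cball 0 1 \<Longrightarrow> norm (F1 l) \<le> M1" "\<And>l. l \<in> cball 0 1 \<Longrightarrow> norm (F2 l) \<le> M2"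
  proof -
    have "bounded (F1 ` cball 0 1)" "bounded (F2 ` cball 0 1)"
      using cont by (meson compact_cball compact_continuous_image compact_imp_bounded continuous_on_subset subset_UNIV)+
    then obtain a b where "\<forall>l\<in>cball 0 1. norm (F1 l) \<le> a" "\<forall>l\<in>cball 0 1. norm (F2 l) \<le> b"
      unfolding bounded_iff by blast
    then show thesis using that by blast
  qed
  have M0: "M1 \<ge> 0" "M2 \<ge> 0"
    using order_trans[OF norm_ge_zero M(1)[of 0]] order_trans[OF norm_ge_zero M(2)[of 0]] by auto
  have D1_norm: "norm (D1 l x) \<le> K * norm x * M1" if "l \<in> cball 0 1" for l x
  proof -
    have "norm (D1 l x) \<le> norm (B x) * norm (F1 l)"
      unfolding D1_def by (rule norm_blinfun_compose)
    also have "\<dots> \<le> K * norm x * M1"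
      using B_norm M(1)[OF that] K(1) by (intro mult_mono) auto
    finally show ?thesis .
  qed
  have D2_norm: "norm (D2 l x) \<le> K * norm x * M2" if "l \<in> cball 0 1" for l x
  proof (rule norm_blinfun_bound)
    show "0 \<le> K * norm x * M2" using K(1) M0 by simp
    fix v
    have "norm (D2 l x v) \<le> norm (B x) * norm (F2 l v)"
      unfolding D2_apply by (rule norm_blinfun_compose)
    also have "\<dots> \<le> (K * norm x) * (M2 * norm v)"
      using B_norm[of x] K(1) M0 norm_blinfun[of "F2 l" v] mult_right_mono[OF M(2)[OF that], of "norm v"]
      by (intro mult_mono) auto
    finally show "norm (D2 l x v) \<le> K * norm x * M2 * norm v" by (simp add: mult_ac)
  qed

  define Q where "Q l u = (\<chi> i j. inner (F1 l (axis j 1) $ i) u)" for l u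
  have Q: "matrix (blinfun_apply (D1 l u)) = Q l u" for l u
    by (simp add: matrix_def Q_def D1_def B_apply frame_coords_def)
  define G where "G z = (norm (frame_coords (e (fst z)) (snd z)))\<^sup>2 +
    det (Q (fst z) (snd z) ** transpose (Q (fst z) (snd z)))" for z
  have cont_e: "continuous_on UNIV e" using Ck_imp_continuous_on[OF e] .
  have contG: "continuous_on UNIV G"
    unfolding G_def det_def matrix_matrix_mult_def transpose_def Q_def
    by (simp, intro continuous_intros frame_coords.continuous_on
        continuous_on_compose2[OF cont_e] continuous_on_compose2[OF cont(1)]) auto
  \<comment> \<open>Either the projection of \<open>u\<close> is nonzero, or \<open>u\<close> is
    orthogonal to the base space and \<open>nondeg\<close> excludes a vanishing determinant. The
    determinant is nonnegative in both cases.\<close>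
  have Gpos: "G (0, u) > 0" if u: "norm u = 1" for u
  proof (cases "frame_coords (e 0) u = 0")
    case True
    then have perp: "inner (e 0 $ i) u = 0" for i by (simp add: frame_coords_def vec_eq_iff)
    have "det (Q 0 u ** transpose (Q 0 u)) \<noteq> 0"
    proof
      assume "det (Q 0 u ** transpose (Q 0 u)) = 0"
      then obtain t where t: "t \<noteq> 0" "transpose (Q 0 u) *v t = 0"
        by (rule transpose_ker_of_det_0)
      obtain v where v: "(\<Sum>i\<in>UNIV. t $ i * inner (e' v $ i) u) \<noteq> 0"
        using nondeg[OF u perp t(1)] by blast
      have "(\<Sum>i\<in>UNIV. t $ i * inner (e' v $ i) u) = inner t (D1 0 u v)"
        by (simp add: e'_eq D1_def B_apply frame_coords_def inner_vec_def)
      also have "D1 0 u v = Q 0 u *v v"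
        unfolding Q[symmetric]
        by (simp add: matrix_works linear_matrix_vector_mul_eq bounded_linear.linear[OF blinfun.bounded_linear_right])
      also have "inner t (Q 0 u *v v) = inner (transpose (Q 0 u) *v t) v"
        by (simp add: dot_lmul_matrix[symmetric] transpose_matrix_vector)
      finally show False using v t(2) by simp
    qed
    then show ?thesis
      using det_nonneg_of_psd[OF matrix_mult_transpose_psd, of "Q 0 u"] True by (simp add: G_def)
  next
    case False
    then show ?thesis
      using det_nonneg_of_psd[OF matrix_mult_transpose_psd, of "Q 0 u"]
      by (auto simp: G_def intro: add_pos_nonneg)
  qed
  have "\<exists>c>0. \<forall>u. norm u = 1 \<longrightarrow> c \<le> G (0, u)"
  proof -
    have "\<exists>u\<in>sphere 0 1. \<forall>v\<in>sphere 0 1. G (0, u) \<le> G (0, v)"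
      by (rule continuous_attains_inf)
        (auto intro!: continuous_on_compose2[OF contG] continuous_intros simp: sphere_eq_empty)
    then show ?thesis using Gpos by (metis dist_0_norm mem_sphere)
  qed
  then obtain c where c: "c > 0" "\<And>u. norm u = 1 \<Longrightarrow> c \<le> G (0, u)" by blast
  have "uniformly_continuous_on (cball 0 1 \<times> sphere 0 1) G"
    by (intro compact_uniformly_continuous compact_Times compact_cball compact_sphere continuous_on_subset[OF contG]) auto
  then obtain d where d: "d > 0" "\<And>z z'. z \<in> cball 0 1 \<times> sphere 0 1 \<Longrightarrow> z' \<in> cball 0 1 \<times> sphere 0 1 \<Longrightarrow>
      dist z' z < d \<Longrightarrow> dist (G z') (G z) < c / 2"
    unfolding uniformly_continuous_on_def using c(1) by (meson half_gt_zero)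
  \<comment> \<open>Closer than \<open>d\<close> to 0, \<open>G (l, u)\<close> differs from
    \<open>G (0, u)\<close> by less than \<open>c / 2\<close>; the bound 1 keeps \<open>l\<close> in
    the compact ball where \<open>M1\<close> and \<open>M2\<close> apply.\<close>
  define r where "r = min d 1"
  have r: "r > 0" "ball 0 r \<subseteq> cball (0 :: real^'p) 1" using d(1) by (auto simp: r_def)
  have Gbig: "G (l, u) \<ge> c / 2" if "l \<in> ball 0 r" "norm u = 1" for l u
  proof -
    have "dist (G (l, u)) (G (0, u)) < c / 2"
      using that r by (intro d(2)) (auto simp: dist_Pair_Pair r_def)
    then show ?thesis using c(2)[OF that(2)] unfolding dist_real_def by linarith
  qed
  \<comment> \<open>By linearity in the point, the difference quotient depends only on the unit
    direction, which makes the bounds below uniform as \<open>x\<close> approaches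
    \<open>y\<close>.\<close>
  have Phi_eq: "Phi (\<lambda>l x. frame_coords (e l) x) x y = (\<lambda>l. frame_coords (e l) ((x - y) /\<^sub>R norm (x - y)))" for x y
    by (simp add: Phi_def fun_eq_iff frame_coords.diff_right frame_coords.scaleR_right)
  have unit: "norm ((x - y) /\<^sub>R norm (x - y)) = 1" if "x \<noteq> y" for x y :: "real^'N"
    using that by simp
  have "transversal (ball 0 r) (\<lambda>l x. frame_coords (e l) x)"
    unfolding transversal_def
  proof (intro conjI allI impI)
    show "open (ball (0 :: real^'p) r)" by simp
    fix S :: "(real^'N) set" assume "compact S"
    then obtain R where R: "\<And>x. x \<in> S \<Longrightarrow> norm x \<le> R"
      using compact_imp_bounded bounded_iff by metis
    have "Ck 1 UNIV e" using Ck_Suc_D[of 1 UNIV e] e by (simp only: Suc_1)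
    then show "Ck 1 (ball 0 r \<times> S) (\<lambda>z. frame_coords (e (fst z)) (snd z))"
      by (intro Ck_bilinear[OF bounded_bilinear_frame_coords] Ck_compose_linear[OF bounded_linear_fst]
          Ck_bounded_linear_compose[OF bounded_linear_snd] Ck_ident)
    have "norm (D1 l x) \<le> K * R * M1 \<and> norm (D2 l x) \<le> K * R * M2" if "l \<in> ball 0 r" "x \<in> S" for l x
    proof -
      have "K * norm x * M1 \<le> K * R * M1" "K * norm x * M2 \<le> K * R * M2"
        using R[OF that(2)] K(1) M0 by (auto intro!: mult_right_mono mult_left_mono)
      then show ?thesis
        using D1_norm[of l x] D2_norm[of l x] that(1) r(2) by (meson order_trans subsetD)
    qed
    then show "\<exists>D1 D2 C1 C2. \<forall>l\<in>ball 0 r. \<forall>x\<in>S.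
          ((\<lambda>l'. frame_coords (e l') x) has_derivative blinfun_apply (D1 l x)) (at l) \<and>
          ((\<lambda>l'. D1 l' x) has_derivative blinfun_apply (D2 l x)) (at l) \<and>
          norm (D1 l x) \<le> C1 \<and> norm (D2 l x) \<le> C2"
      by (intro exI[of _ D1] exI[of _ D2] exI[of _ "K * R * M1"] exI[of _ "K * R * M2"]) (auto intro: D1 D2)
    show "\<exists>CT>0. \<forall>x\<in>S. \<forall>y\<in>S. x \<noteq> y \<longrightarrow> (\<forall>l\<in>ball 0 r. \<forall>D.
          (Phi (\<lambda>l. frame_coords (e l)) x y has_derivative blinfun_apply D) (at l) \<longrightarrow>
          norm (Phi (\<lambda>l. frame_coords (e l)) x y l) \<le> CT \<longrightarrow>
          det (matrix (blinfun_apply D) ** transpose (matrix (blinfun_apply D))) \<ge> CT\<^sup>2)"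
    \<comment> \<open>If the quotient has squared norm at most \<open>c / 4\<close>, the determinant
      is at least \<open>c / 2 - c / 4\<close>, which is the square of the chosen constant.\<close>
    proof (intro exI[of _ "sqrt (c / 4)"] conjI ballI impI allI)
      show "sqrt (c / 4) > 0" using c(1) by simp
      fix x y l D
      assume "x \<noteq> y" and l: "l \<in> ball 0 r"
        and D: "(Phi (\<lambda>l. frame_coords (e l)) x y has_derivative blinfun_apply D) (at l)"
        and small: "norm (Phi (\<lambda>l. frame_coords (e l)) x y l) \<le> sqrt (c / 4)"
      define u where "u = (x - y) /\<^sub>R norm (x - y)"
      have u: "norm u = 1" unfolding u_def using unit[OF \<open>x \<noteq> y\<close>] .
      have "blinfun_apply D = blinfun_apply (D1 l u)"
        using has_derivative_unique[OF D] D1[of u l] unfolding Phi_eq u_def by blast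
      then have "det (matrix (blinfun_apply D) ** transpose (matrix (blinfun_apply D))) =
          G (l, u) - (norm (frame_coords (e l) u))\<^sup>2"
        by (simp add: G_def Q)
      moreover have "(norm (frame_coords (e l) u))\<^sup>2 \<le> (sqrt (c / 4))\<^sup>2"
        using small unfolding Phi_eq u_def by (rule power_mono) simp
      ultimately show "(sqrt (c / 4))\<^sup>2 \<le> det (matrix (blinfun_apply D) ** transpose (matrix (blinfun_apply D)))"
        using Gbig[OF l u] c(1) by simp
    qed
    show "\<exists>CL. \<forall>x\<in>S. \<forall>y\<in>S. x \<noteq> y \<longrightarrow> (\<forall>DP D2P.
          (\<forall>l\<in>ball 0 r. (Phi (\<lambda>l. frame_coords (e l)) x y has_derivative blinfun_apply (DP l)) (at l) \<and>
                  (DP has_derivative blinfun_apply (D2P l)) (at l)) \<longrightarrow>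
          (\<forall>l\<in>ball 0 r. norm (D2P l) \<le> CL))"
    proof (intro exI[of _ "K * M2"] ballI impI allI)
      fix x y and DP :: "real^'p \<Rightarrow> (real^'p) \<Rightarrow>\<^sub>L (real^'m)" and D2P and l :: "real^'p"
      assume "x \<noteq> y" and l: "l \<in> ball 0 r"
        and DP: "\<forall>l\<in>ball 0 r. (Phi (\<lambda>l. frame_coords (e l)) x y has_derivative blinfun_apply (DP l)) (at l) \<and>
                  (DP has_derivative blinfun_apply (D2P l)) (at l)"
      define u where "u = (x - y) /\<^sub>R norm (x - y)"
      have u: "norm u = 1" unfolding u_def using unit[OF \<open>x \<noteq> y\<close>] .
      have DP_eq: "DP l' = D1 l' u" if "l' \<in> ball 0 r" for l'
      proof -
        have "blinfun_apply (DP l') = blinfun_apply (D1 l' u)"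
          using DP that has_derivative_unique[OF _ D1[of u l']] unfolding Phi_eq u_def by blast
        then show ?thesis by (simp add: blinfun_apply_inject)
      qed
      \<comment> \<open>\<open>DP\<close> is known to agree with \<open>D1\<close> only on the ball;
        openness of the ball transfers the derivative at \<open>l\<close>.\<close>
      have "(DP has_derivative blinfun_apply (D2 l u)) (at l)"
        using D2 by (rule has_derivative_transform_within_open[OF _ open_ball l]) (simp add: DP_eq)
      then have "blinfun_apply (D2P l) = blinfun_apply (D2 l u)"
        using DP l has_derivative_unique by blast
      then have "D2P l = D2 l u" by (simp add: blinfun_apply_inject)
      then show "norm (D2P l) \<le> K * M2"
        using D2_norm[of l u] u l r(2) by auto
    qed
  qed
  then show ?thesis unfolding frame_coords_def using r(1) by blast
qed

section \<open>Derivatives of the graph, of its orthonormal frame and of the chart\<close>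

context isotropic_frame
begin

lemma Ck_graph:
  assumes "bounded_linear a"
  shows "Ck k S (\<lambda>l. graph (a l) $ i)"
proof -
  have a: "Ck k S (\<lambda>l. a l $ i)" for i
    by (intro Ck_vec_nth Ck_bounded_linear_compose[OF assms] Ck_ident)
  have J: "Ck k S (\<lambda>l. Jop (a l $ i))" for i
    using linear_Jop by (intro Ck_bounded_linear_compose[where L = Jop] a) (simp add: linear_conv_bounded_linear)
  have "Ck k S (\<lambda>l. e0 $ i + a l $ i -
      (\<Sum>j\<in>UNIV. (inner (a l $ i) (Jop (a l $ j)) * (1 / 2)) *\<^sub>R Jop (e0 $ j)))"
    by (intro Ck_diff Ck_add Ck_sum Ck_scaleR Ck_mult Ck_inner Ck_const a J)
  then show ?thesis by (simp add: graph_def)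
qed

lemma graph_0: "graph 0 = e0"
  by (simp add: graph_def vec_eq_iff)

text \<open>The correction in \<open>graph\<close> is quadratic in the parameter, so its derivative
  at the origin is zero.\<close>

lemma has_derivative_graph_0:
  assumes a: "bounded_linear a"
  shows "((\<lambda>l. graph (a l) $ i) has_derivative (\<lambda>v. a v $ i)) (at 0)"
proof -
  have a0: "a 0 = 0" using a by (rule linear_simps(3))
  have da: "((\<lambda>l. a l $ i) has_derivative (\<lambda>v. a v $ i)) (at 0)" for i
    by (intro bounded_linear_imp_has_derivative bounded_linear_compose[OF bounded_linear_vec_nth a])
  have dJ: "((\<lambda>l. Jop (a l $ i)) has_derivative (\<lambda>v. Jop (a v $ i))) (at 0)" for i
    using bounded_linear.has_derivative[OF linear_Jop[unfolded linear_conv_bounded_linear] da] .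
  have quad: "((\<lambda>l. inner (a l $ i) (Jop (a l $ j))) has_derivative (\<lambda>v. 0)) (at 0)" for j
    using has_derivative_inner[OF da[of i] dJ[of j]] by (simp add: a0 linear_0[OF linear_Jop])
  have "((\<lambda>l. inner (a l $ i) (Jop (a l $ j)) *\<^sub>R ((1 / 2) *\<^sub>R Jop (e0 $ j))) has_derivative
      (\<lambda>v. 0 *\<^sub>R ((1 / 2) *\<^sub>R Jop (e0 $ j)))) (at 0)" for j
    by (rule bounded_linear.has_derivative[OF bounded_linear_scaleR_left quad])
  then have half: "((\<lambda>l. inner (a l $ i) (Jop (a l $ j)) *\<^sub>R ((1 / 2) *\<^sub>R Jop (e0 $ j))) has_derivative (\<lambda>v. 0)) (at 0)" for j
    by simp
  have "((\<lambda>l. \<Sum>j\<in>UNIV. inner (a l $ i) (Jop (a l $ j)) *\<^sub>R ((1 / 2) *\<^sub>R Jop (e0 $ j)))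
      has_derivative (\<lambda>v. \<Sum>j\<in>(UNIV :: 'm set). 0)) (at 0)"
    using half by (rule has_derivative_sum)
  then have "((\<lambda>l. e0 $ i + a l $ i - (\<Sum>j\<in>UNIV. inner (a l $ i) (Jop (a l $ j)) *\<^sub>R ((1 / 2) *\<^sub>R Jop (e0 $ j))))
      has_derivative (\<lambda>v. 0 + a v $ i - (\<Sum>j\<in>(UNIV :: 'm set). 0))) (at 0)"
    by (intro has_derivative_diff has_derivative_add has_derivative_const da)
  then show ?thesis by (simp add: graph_def)
qed

lemma smooth_orthonormal_graph_frame:
  fixes a :: "'p::euclidean_space \<Rightarrow> (real^('n + 'n))^'m"
  assumes a: "bounded_linear a" "\<And>l. a l \<in> tangent"
  obtains e :: "'p \<Rightarrow> (real^('n + 'n))^'m" where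
    "\<And>k S. Ck k S e" "\<And>l i j. inner (e l $ i) (e l $ j) = (if i = j then 1 else 0)"
    "\<And>l. span (range (\<lambda>i. e l $ i)) = span_graph (a l)" "e 0 = e0"
proof -
  have "\<exists>g. (\<forall>k. \<forall>i\<in>UNIV. Ck k UNIV (\<lambda>l. g l i)) \<and>
    (\<forall>l\<in>UNIV. \<forall>i\<in>UNIV. \<forall>j\<in>UNIV. inner (g l i) (g l j) = (if i = j then 1 else 0)) \<and>
    (\<forall>l\<in>UNIV. span (g l ` UNIV) = span ((\<lambda>i. graph (a l) $ i) ` UNIV)) \<and>
    (\<forall>l\<in>UNIV. (\<forall>i\<in>UNIV. \<forall>j\<in>UNIV. inner (graph (a l) $ i) (graph (a l) $ j) = (if i = j then 1 else 0)) \<longrightarrow>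
      (\<forall>i\<in>UNIV. g l i = graph (a l) $ i))"
    using smooth_Gram_Schmidt[of UNIV UNIV "\<lambda>l i. graph (a l) $ i"] Ck_graph[OF a(1)] graph_notin_span[OF a(2)]
    by simp
  then obtain g where g: "\<And>k i. Ck k UNIV (\<lambda>l. g l i)" "\<And>l i j. inner (g l i) (g l j) = (if i = j then 1 else 0)"
    "\<And>l. span (range (g l)) = span_graph (a l)"
    "\<And>l i. (\<And>i j. inner (graph (a l) $ i) (graph (a l) $ j) = (if i = j then 1 else 0)) \<Longrightarrow> g l i = graph (a l) $ i"
    unfolding span_graph_def by (metis UNIV_I)
  have "a 0 = 0" using a(1) by (rule linear_simps(3))
  then have "g 0 i = e0 $ i" for i
    using g(4)[of 0 i] orthonormal by (simp add: graph_0)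
  show thesis
  proof (rule that[of "\<lambda>l. \<chi> i. g l i"])
    show "Ck k S (\<lambda>l. \<chi> i. g l i)" for k S
      using Ck_compose_linear[OF bounded_linear_ident, of k "\<lambda>l. \<chi> i. g l i" S] Ck_vec_lambda[of k UNIV g, OF g(1)] by simp
    show "inner ((\<chi> i. g l i) $ i) ((\<chi> i. g l i) $ j) = (if i = j then 1 else 0)" for l i j
      by (simp only: vec_lambda_beta g(2))
    show "span (range (\<lambda>i. (\<chi> i. g l i) $ i)) = span_graph (a l)" for l
      by (simp only: vec_lambda_beta g(3))
    show "(\<chi> i. g 0 i) = e0"
      by (simp add: vec_eq_iff \<open>\<And>i. g 0 i = e0 $ i\<close>)
  qed
qed

text \<open>Let \<open>D v = 0\<close>. Differentiating the identity that the projection fixes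
  \<open>graph (a l) $ i\<close> puts \<open>F i v\<close> into \<open>span_graph (a l)\<close>. Its
  products with \<open>e0\<close> vanish, because those of the graph are constant, so
  \<open>F i v = 0\<close>. As \<open>tangent_part\<close> recovers \<open>a\<close> linearly from
  the graph, \<open>a v = 0\<close>.\<close>

lemma inj_derivative_projmat_span_graph:
  fixes a :: "real^'p::finite \<Rightarrow> (real^('n + 'n))^'m"
  assumes a: "bounded_linear a" "\<And>l. a l \<in> tangent" "\<And>l. norm (a l) = norm l"
    and D: "((\<lambda>l. projmat (span_graph (a l))) has_derivative D) (at l)"
  shows "inj D"
proof -
  have "linear D" using D by (rule has_derivative_linear)
  have "v = 0" if "D v = 0" for v
  proof -
    have "Ck 1 UNIV (\<lambda>l. graph (a l) $ i)" for i by (rule Ck_graph[OF a(1)])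
    then have "\<exists>F. ((\<lambda>l. graph (a l) $ i) has_derivative F) (at l)" for i
      unfolding One_nat_def Ck.simps(2) by blast
    then obtain F where F: "\<And>i. ((\<lambda>l. graph (a l) $ i) has_derivative F i) (at l)" by metis
    have "F i v = 0" for i
    proof -
      have "((\<lambda>l. projmat (span_graph (a l)) *v graph (a l) $ i) has_derivative
          (\<lambda>v. projmat (span_graph (a l)) *v F i v + D v *v graph (a l) $ i)) (at l)"
        by (rule bounded_bilinear.FDERIV[OF bounded_bilinear_matrix_vector_mult D F])
      moreover have "projmat (span_graph A) *v graph A $ i = graph A $ i" for A
        using mem_subspace_iff_projmat[of "span_graph A"] graph_in_span_graph[of A i]
        by (simp add: span_graph_def)
      ultimately have "((\<lambda>l. graph (a l) $ i) has_derivative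
          (\<lambda>v. projmat (span_graph (a l)) *v F i v + D v *v graph (a l) $ i)) (at l)"
        by simp
      from fun_cong[OF has_derivative_unique[OF this F]]
      have "projmat (span_graph (a l)) *v F i v + D v *v graph (a l) $ i = F i v" .
      then have mem: "F i v \<in> span_graph (a l)"
        using that mem_subspace_iff_projmat[of "span_graph (a l)"] by (simp add: span_graph_def)
      have "inner (F i v) (e0 $ j) = 0" for j
      proof -
        have "((\<lambda>l. inner (graph (a l) $ i) (e0 $ j)) has_derivative (\<lambda>v. inner (F i v) (e0 $ j))) (at l)"
          by (rule bounded_linear.has_derivative[OF bounded_linear_inner_left F])
        moreover have "((\<lambda>l. inner (graph (a l) $ i) (e0 $ j)) has_derivative (\<lambda>v. 0)) (at l)"
          by (simp add: inner_graph_e0[OF a(2)])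
        ultimately show ?thesis by (metis has_derivative_unique)
      qed
      then show ?thesis using span_graph_expand[OF a(2) mem] by simp
    qed
    define G where "G v = (\<Sum>i\<in>UNIV. axis i (F i v))" for v
    have "((\<lambda>l. \<Sum>i\<in>UNIV. axis i (graph (a l) $ i)) has_derivative G) (at l)"
      unfolding G_def by (intro has_derivative_sum bounded_linear.has_derivative[OF bounded_linear_axis] F)
    then have "((\<lambda>l. graph (a l)) has_derivative G) (at l)"
      by (simp flip: vec_lambda_eq_sum_axis)
    from has_derivative_diff[OF this has_derivative_const[of e0]]
    have "((\<lambda>l. graph (a l) - e0) has_derivative G) (at l)" by simp
    then have "((\<lambda>l. tangent_part (graph (a l) - e0)) has_derivative (\<lambda>v. tangent_part (G v))) (at l)"
      by (rule bounded_linear.has_derivative[OF linear_tangent_part[unfolded linear_conv_bounded_linear]])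
    then have "(a has_derivative (\<lambda>v. tangent_part (G v))) (at l)"
      by (simp add: tangent_part_graph[OF a(2)])
    then have "(\<lambda>v. tangent_part (G v)) = a"
      by (rule has_derivative_unique[OF _ bounded_linear_imp_has_derivative[OF a(1)]])
    moreover have "G v = 0"
      using \<open>\<And>i. F i v = 0\<close> by (simp add: G_def linear_0 bounded_linear.linear[OF bounded_linear_axis])
    ultimately have "a v = 0" using linear_0[OF linear_tangent_part] by metis
    then show "v = 0" using a(3)[of v] by simp
  qed
  then show ?thesis using linear_injective_0[OF \<open>linear D\<close>] by blast
qed

text \<open>Expand \<open>e l $ i\<close> in the graph vectors and differentiate at 0. Changes of
  the coefficients multiply vectors of \<open>e0\<close>, which are orthogonal to \<open>u\<close>,
  so \<open>inner (e' v $ i) u = inner (a v $ i) u\<close> and \<open>tangent_transversal\<close>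
  applies. Gram-Schmidt itself is never differentiated explicitly.\<close>

lemma nondegenerate_at_0:
  fixes a e :: "real^'p::finite \<Rightarrow> (real^('n + 'n))^'m"
  assumes a: "bounded_linear a" "range a = tangent"
    and e: "\<And>l. span (range (\<lambda>i. e l $ i)) = span_graph (a l)" "e 0 = e0" "(e has_derivative e') (at 0)"
    and u: "norm u = 1" "\<And>i. inner (e 0 $ i) u = 0" and t: "t \<noteq> 0"
  shows "\<exists>v. (\<Sum>i\<in>UNIV. t $ i * inner (e' v $ i) u) \<noteq> 0"
proof -
  have a0: "a 0 = 0" using a(1) by (rule linear_simps(3))
  have perp: "inner (e0 $ i) u = 0" for i using u(2) e(2) by simp
  have at: "a l \<in> tangent" for l using a(2) by auto
  have de: "((\<lambda>l. e l $ i) has_derivative (\<lambda>v. e' v $ i)) (at 0)" for i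
    by (rule bounded_linear.has_derivative[OF bounded_linear_vec_nth e(3)])
  have "inner (e' v $ i) u = inner (a v $ i) u" for v i
  proof -
    have "e l $ i \<in> span_graph (a l)" for l
      unfolding e(1)[symmetric] by (rule span_base) simp
    then have eq: "e l $ i = (\<Sum>j\<in>UNIV. inner (e l $ i) (e0 $ j) *\<^sub>R graph (a l) $ j)" for l
      using span_graph_expand[OF at] by metis
    have dsum: "((\<lambda>l. inner (\<Sum>j\<in>UNIV. inner (e l $ i) (e0 $ j) *\<^sub>R graph (a l) $ j) u) has_derivative
       (\<lambda>v. inner (\<Sum>j\<in>UNIV. inner (e 0 $ i) (e0 $ j) *\<^sub>R a v $ j + inner (e' v $ i) (e0 $ j) *\<^sub>R graph (a 0) $ j) u)) (at 0)"
      by (intro bounded_linear.has_derivative[OF bounded_linear_inner_left] has_derivative_sum has_derivative_scaleR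
          de has_derivative_graph_0[OF a(1)])
    have "((\<lambda>l. inner (e l $ i) u) has_derivative
       (\<lambda>v. inner (\<Sum>j\<in>UNIV. inner (e 0 $ i) (e0 $ j) *\<^sub>R a v $ j + inner (e' v $ i) (e0 $ j) *\<^sub>R graph (a 0) $ j) u)) (at 0)"
      using dsum unfolding eq[symmetric] .
    moreover have "((\<lambda>l. inner (e l $ i) u) has_derivative (\<lambda>v. inner (e' v $ i) u)) (at 0)"
      by (rule bounded_linear.has_derivative[OF bounded_linear_inner_left de])
    ultimately have "(\<lambda>v. inner (e' v $ i) u) =
       (\<lambda>v. inner (\<Sum>j\<in>UNIV. inner (e 0 $ i) (e0 $ j) *\<^sub>R a v $ j + inner (e' v $ i) (e0 $ j) *\<^sub>R graph (a 0) $ j) u)"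
      by (intro has_derivative_unique)
    then have "inner (e' v $ i) u = inner (\<Sum>j\<in>UNIV. inner (e 0 $ i) (e0 $ j) *\<^sub>R a v $ j + inner (e' v $ i) (e0 $ j) *\<^sub>R graph (a 0) $ j) u"
      by (rule fun_cong[where f = "\<lambda>v. inner (e' v $ i) u"])
    also have "\<dots> = (\<Sum>j\<in>UNIV. inner (a v $ j) u * inner (e0 $ i) (e0 $ j))"
      by (simp add: e(2) a0 graph_0 perp inner_sum_left inner_add_left mult.commute)
    finally show ?thesis by (simp add: sum_e0)
  qed
  moreover obtain A where "A \<in> tangent" "(\<Sum>i\<in>UNIV. t $ i * inner (A $ i) u) \<noteq> 0"
    using tangent_transversal[OF u(1) perp t] by blast
  moreover then obtain v where "A = a v" using a(2) by blast
  ultimately show ?thesis by auto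
qed

end

section \<open>The chart around \<open>V0\<close> and transversality of the local family\<close>

theorem theorem1p1:
  fixes V0 :: "(real^('n::finite + 'n)) set"
  assumes m_le_n: "CARD('m::finite) \<le> CARD('n)"
    and l_dim: "CARD('p::finite) = 2 * CARD('n) * CARD('m) - CARD('m) * (3 * CARD('m) - 1) div 2"
    and V0: "V0 \<in> iso_grass CARD('m)"
  shows "\<exists>(\<Lambda> :: (real^'p) set) (e :: real^'p \<Rightarrow> (real^('n + 'n))^'m).
     open \<Lambda> \<and>
     \<comment> \<open>e l is an orthonormal basis of the isotropic subspace V(l) = span of its vectors\<close>
     (\<forall>l\<in>\<Lambda>. \<forall>i j. inner (e l $ i) (e l $ j) = (if i = j then 1 else 0)) \<and>
     (\<forall>l\<in>\<Lambda>. span (range (\<lambda>i. e l $ i)) \<in> iso_grass CARD('m)) \<and>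
     \<comment> \<open>the frame depends smoothly on l\<close>
     (\<forall>k. Ck k \<Lambda> e) \<and>
     \<comment> \<open>l \<mapsto> V(l) is a chart: a smooth immersive homeomorphism of \<Lambda> onto an open
         neighbourhood U of V0 in G_h(n,m)\<close>
     V0 \<in> (\<lambda>l. span (range (\<lambda>i. e l $ i))) ` \<Lambda> \<and>
     (\<exists>T. open T \<and> projmat ` ((\<lambda>l. span (range (\<lambda>i. e l $ i))) ` \<Lambda>)
                  = projmat ` iso_grass CARD('m) \<inter> T) \<and>
     (\<exists>g. homeomorphism \<Lambda> ((\<lambda>l. projmat (span (range (\<lambda>i. e l $ i)))) ` \<Lambda>)
                         (\<lambda>l. projmat (span (range (\<lambda>i. e l $ i)))) g) \<and>
     (\<forall>l\<in>\<Lambda>. \<forall>D. ((\<lambda>l. projmat (span (range (\<lambda>i. e l $ i)))) has_derivative D) (at l)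
                  \<longrightarrow> inj D) \<and>
     \<comment> \<open>the family of projections P_V, V = V(l), written in the basis e l, is transversal\<close>
     transversal \<Lambda> (\<lambda>l x. \<chi> i. inner (e l $ i) x)"
proof -
  have V0': "subspace V0" "dim V0 = CARD('m)" "isotropic V0"
    using V0 by (auto simp: iso_grass_def)
  obtain e0 :: "(real^('n + 'n))^'m" where e0:
    "\<And>i j. inner (e0 $ i) (e0 $ j) = (if i = j then 1 else 0)" "span (range (\<lambda>i. e0 $ i)) = V0"
    using ex_orthonormal_frame[OF V0'(1,2)] by blast
  have "e0 $ i \<in> V0" for i
    unfolding e0(2)[symmetric] by (rule span_base) simp
  then interpret isotropic_frame e0
    using e0(1) V0'(3) by unfold_locales (auto simp: isotropic_def symp_eq_inner_Jop)
  \<comment> \<open>Equal dimensions give a linear isometry of the parameter space onto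
    \<open>tangent\<close>, so distances between parameters can be measured on either side.\<close>
  have "dim (UNIV :: (real^'p) set) = dim tangent"
    using l_dim dim_tangent by simp
  then obtain a :: "real^'p \<Rightarrow> (real^('n + 'n))^'m" where
    a: "linear a" "a ` UNIV = tangent" "\<And>l. norm (a l) = norm l"
    using isometries_subspaces[OF subspace_UNIV subspace_tangent] by (metis UNIV_I)
  have abl: "bounded_linear a" using a(1) by (simp add: linear_conv_bounded_linear)
  have at: "a l \<in> tangent" for l using a(2) by auto
  obtain e where e: "\<And>k S. Ck k S e" "\<And>l i j. inner (e l $ i) (e l $ j) = (if i = j then 1 else 0)"
    "\<And>l. span (range (\<lambda>i. e l $ i)) = span_graph (a l)" "e 0 = e0"
    using smooth_orthonormal_graph_frame[OF abl at] by metis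
  have "Ck 1 UNIV e" by (rule e(1))
  then obtain e' where e': "(e has_derivative e') (at 0)" by auto
  obtain r where r: "r > 0" "transversal (ball 0 r) (\<lambda>l x. \<chi> i. inner (e l $ i) x)"
    using transversal_near_nondegenerate[OF e(1) e' nondegenerate_at_0[OF abl a(2) e(3,4) e']] by blast
  have iso: "span_graph (a l) \<in> iso_grass CARD('m)" for l
    using isotropic_span_graph[OF at] dim_span_orthonormal[OF e(2)]
    by (auto simp: iso_grass_def e(3) span_graph_def)
  have sub: "subspace (span_graph A)" for A by (simp add: span_graph_def)
  have inj_a: "l = l'" if "a l = a l'" for l l'
    using a(3)[of "l - l'"] linear_diff[OF a(1), of l l'] that by simp
  have inj: "l = l'" if "projmat (span_graph (a l)) = projmat (span_graph (a l'))" for l l'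
    using inj_a span_graph_inj[OF at at] subspace_eq_of_projmat_eq[OF sub sub that] by blast
  define chart where "chart l = projmat (span_graph (a l))" for l
  have "continuous_on UNIV chart"
    using continuous_on_projmat_frame[OF Ck_imp_continuous_on[OF e(1)[of 0 UNIV]]] e(2)
    by (simp add: chart_def[abs_def] e(3))
  \<comment> \<open>A continuous injection on the compact closed ball is a homeomorphism onto its
    image; this restricts to the open ball.\<close>
  then have "\<exists>g. homeomorphism (cball 0 r) (chart ` cball 0 r) chart g"
    using inj by (intro homeomorphism_compact)
      (auto simp: inj_on_def chart_def intro: continuous_on_subset)
  then have homeo: "\<exists>g. homeomorphism (ball 0 r) (chart ` ball 0 r) chart g"
    by (elim ex_forward homeomorphism_of_subsets[where T'' = "chart ` cball 0 r"]) auto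
  \<comment> \<open>With the distance \<open>r - norm l\<close> to the boundary as tolerance,
    \<open>span_graph_nearby\<close> keeps the parameters of nearby subspaces inside the ball. The
    balls of radius \<open>\<epsilon> l\<close> around \<open>chart l\<close> then make up the open
    set \<open>T\<close>.\<close>
  have "\<exists>\<epsilon>>0. \<forall>V\<in>iso_grass CARD('m). norm (projmat V - chart l) < \<epsilon> \<longrightarrow> (\<exists>l'\<in>ball 0 r. V = span_graph (a l'))"
    if l: "l \<in> ball 0 r" for l
  proof -
    have "r - norm l > 0" using l by simp
    from span_graph_nearby[OF at[of l] this] obtain \<epsilon> where \<epsilon>: "\<epsilon> > 0"
      "\<And>V. V \<in> iso_grass CARD('m) \<Longrightarrow> norm (projmat V - chart l) < \<epsilon> \<Longrightarrow>
        \<exists>B\<in>tangent. norm (B - a l) < r - norm l \<and> V = span_graph B"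
      unfolding chart_def by blast
    have "\<exists>l'\<in>ball 0 r. V = span_graph (a l')" if V: "V \<in> iso_grass CARD('m)" "norm (projmat V - chart l) < \<epsilon>" for V
    proof -
      obtain B where B: "B \<in> tangent" "norm (B - a l) < r - norm l" "V = span_graph B"
        using \<epsilon>(2)[OF V] by blast
      then obtain l' where l': "B = a l'" using a(2) by blast
      have "norm (l' - l) < r - norm l"
        using B(2) a(3)[of "l' - l"] by (simp add: l' linear_diff[OF a(1)])
      then have "l' \<in> ball 0 r"
        using norm_triangle_sub[of l' l] by simp
      with B(3) l' show ?thesis by blast
    qed
    with \<epsilon>(1) show ?thesis by blast
  qed
  then obtain \<epsilon> where \<epsilon>: "\<And>l. l \<in> ball 0 r \<Longrightarrow> \<epsilon> l > 0"
    "\<And>l V. l \<in> ball 0 r \<Longrightarrow> V \<in> iso_grass CARD('m) \<Longrightarrow> norm (projmat V - chart l) < \<epsilon> l \<Longrightarrow>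
      \<exists>l'\<in>ball 0 r. V = span_graph (a l')"
    by metis
  define T where "T = (\<Union>l\<in>ball 0 r. ball (chart l) (\<epsilon> l))"
  have "projmat ` ((\<lambda>l. span_graph (a l)) ` ball 0 r) = projmat ` iso_grass CARD('m) \<inter> T"
  proof
    show "projmat ` ((\<lambda>l. span_graph (a l)) ` ball 0 r) \<subseteq> projmat ` iso_grass CARD('m) \<inter> T"
      using iso \<epsilon>(1) unfolding T_def chart_def[symmetric] image_image by (force simp: chart_def)
    show "projmat ` iso_grass CARD('m) \<inter> T \<subseteq> projmat ` ((\<lambda>l. span_graph (a l)) ` ball 0 r)"
    proof
      fix M assume "M \<in> projmat ` iso_grass CARD('m) \<inter> T"
      then obtain V l where "V \<in> iso_grass CARD('m)" "M = projmat V" "l \<in> ball 0 r" "dist (chart l) (projmat V) < \<epsilon> l"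
        by (auto simp: T_def)
      then show "M \<in> projmat ` ((\<lambda>l. span_graph (a l)) ` ball 0 r)"
        using \<epsilon>(2)[of l V] by (auto simp: dist_norm norm_minus_commute)
    qed
  qed
  moreover have "open T" unfolding T_def by auto
  moreover have "V0 \<in> (\<lambda>l. span_graph (a l)) ` ball 0 r"
    using e0(2) r(1) e(3)[of 0] e(4) by (intro image_eqI[of _ _ 0]) auto
  moreover have "inj D" if "(chart has_derivative D) (at l)" for l D
    using inj_derivative_projmat_span_graph[OF abl at a(3)] that unfolding chart_def[abs_def] .
  ultimately show ?thesis
    using iso homeo r(2) e(1,2)
    by (intro exI[of _ "ball 0 r"] exI[of _ e]) (auto simp: e(3) chart_def[abs_def])
qed

end
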